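(* Every football pattern on a closed oriented surface admits a branched cover of degree $D\leq 60$ that is also a branched cover of the standard football pattern on $S^2$. The bound for $D$ is sharp: there is a football pattern on a closed oriented surface such that every branched cover of it that is also a branched cover of the standard football pattern on $S^2$ has degree at least $60$ over it.
   Context: A map on a closed (connected) surface is a finite connected graph embedded in the surface such that the complementary components (faces) are open discs. Loops and multiple edges are not excluded. A face is a $k$-gon if its boundary walk has $k$ edges, counted with multiplicity. A football pattern on a closed oriented surface is a map such that at least three edges meet at every vertex, all faces are pentagons and hexagons, across each edge of a pentagon there is a hexagon, and across the edges of each hexagon (in cyclic order) there are alternately pentagons and hexagons. The standard (minimal) football pattern on $S^2$ is the truncated icosahedron, with 12 pentagons, 20 hexagons and exactly three faces at each vertex. A branched cover of a football pattern $P$ on $\Sigma$ is a football pattern $P'$ on a closed connected oriented surface $\Sigma'$ together with an orientation-preserving finite branched covering $\Sigma'\to\Sigma$, branched only in vertices of the pattern, such that $P'$ is the preimage (lift) of $P$. Equivalently, the dual graph of $P'$ is a finite covering of the dual graph of $P$ as ribbon graphs. Here the dual graph has one vertex for each face, coloured black for pentagons and white for hexagons, one edge for each edge of the pattern, and at each vertex the cyclic order given by the sides of the corresponding polygon. Coverings of ribbon graphs are graph coverings preserving colours and cyclic orders. *)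

theory Defs
  imports "HOL-Combinatorics.Orbits"
begin

text \<open>
  A finite graph cellularly embedded in a closed oriented surface is encoded, up to
  orientation-preserving homeomorphism, by its ribbon graph (combinatorial map).
  A dart is an edge together with one of its two directions.  The involution \<open>opp\<close> reverses
  darts, and \<open>rot\<close> sends a dart to the next one, clockwise, among the darts
  with the same initial vertex.  Loops and multiple edges are allowed.
\<close>

record 'a ribbon_graph =
  darts :: "'a set"
  opp :: "'a \<Rightarrow> 'a"
  rot :: "'a \<Rightarrow> 'a"

definition dart_step :: "'a ribbon_graph \<Rightarrow> ('a \<times> 'a) set" where
  "dart_step M = {(d, e). d \<in> darts M \<and> (e = opp M d \<or> e = rot M d)}"

text \<open>
  Nothing is required of \<open>opp\<close> and \<open>rot\<close> outside the set of darts.  Since the set of darts is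
  finite, reachability along \<open>opp\<close> and \<open>rot\<close> is symmetric; it expresses that the
  graph, and hence the surface, is connected.
\<close>

definition surface_map :: "'a ribbon_graph \<Rightarrow> bool" where
  "surface_map M \<longleftrightarrow>
     finite (darts M) \<and> darts M \<noteq> {} \<and>
     (\<forall>d\<in>darts M. opp M d \<in> darts M \<and> opp M d \<noteq> d \<and> opp M (opp M d) = d) \<and>
     bij_betw (rot M) (darts M) (darts M) \<and>
     (\<forall>d\<in>darts M. \<forall>e\<in>darts M. (d, e) \<in> (dart_step M)\<^sup>*)"

definition vertex :: "'a ribbon_graph \<Rightarrow> 'a \<Rightarrow> 'a set" where
  "vertex M d = orbit (rot M) d"

text \<open>
  The face on the left of a dart \<open>d\<close> is traversed counterclockwise.  At the end of \<open>d\<close> its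
  boundary continues with the dart that follows \<open>opp d\<close> in clockwise order.  An edge both of
  whose sides lie on the same face contributes two darts to its boundary walk.
\<close>

definition face_next :: "'a ribbon_graph \<Rightarrow> 'a \<Rightarrow> 'a" where
  "face_next M d = rot M (opp M d)"

definition face :: "'a ribbon_graph \<Rightarrow> 'a \<Rightarrow> 'a set" where
  "face M d = orbit (face_next M) d"

definition vertices :: "'a ribbon_graph \<Rightarrow> 'a set set" where
  "vertices M = vertex M ` darts M"

definition edges :: "'a ribbon_graph \<Rightarrow> 'a set set" where
  "edges M = (\<lambda>d. {d, opp M d}) ` darts M"

definition faces :: "'a ribbon_graph \<Rightarrow> 'a set set" where
  "faces M = face M ` darts M"

definition euler_char :: "'a ribbon_graph \<Rightarrow> int" where
  "euler_char M = int (card (vertices M)) - int (card (edges M)) + int (card (faces M))"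

text \<open>
  The face across the edge of \<open>d\<close>, as seen from the face on the left of \<open>d\<close>, is \<open>face M (opp M d)\<close>.
  The number of edges meeting at a vertex is counted with multiplicity: a loop counts twice.
\<close>

definition pentagon :: "'a ribbon_graph \<Rightarrow> 'a set \<Rightarrow> bool" where
  "pentagon M A \<longleftrightarrow> A \<in> faces M \<and> card A = 5"

definition hexagon :: "'a ribbon_graph \<Rightarrow> 'a set \<Rightarrow> bool" where
  "hexagon M A \<longleftrightarrow> A \<in> faces M \<and> card A = 6"

definition football_pattern :: "'a ribbon_graph \<Rightarrow> bool" where
  "football_pattern M \<longleftrightarrow>
     surface_map M \<and>
     (\<forall>v\<in>vertices M. card v \<ge> 3) \<and>
     (\<forall>A\<in>faces M. pentagon M A \<or> hexagon M A) \<and>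
     (\<forall>d\<in>darts M. pentagon M (face M d) \<longrightarrow> hexagon M (face M (opp M d))) \<and>
     (\<forall>d\<in>darts M. hexagon M (face M d) \<longrightarrow>
        (pentagon M (face M (opp M d)) \<longleftrightarrow>
           hexagon M (face M (opp M (face_next M d)))))"

text \<open>
  In the dual ribbon graph the dart \<open>d\<close> stands for the half of the dual edge that starts in
  the face on the left of \<open>d\<close>.  The rotation at a dual vertex is the counterclockwise order of
  the sides of the polygon.  The dual is thus drawn with the opposite rotation
  convention, which is immaterial here because only duals are compared with each other.
\<close>

definition dual :: "'a ribbon_graph \<Rightarrow> 'a ribbon_graph" where
  "dual M = \<lparr>darts = darts M, opp = opp M, rot = face_next M\<rparr>"

text \<open>
  A covering of graphs is a surjective graph morphism mapping the star of each vertex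
  bijectively onto the star of its image.  Here the colour (black or white) of a dual vertex of a
  football pattern is determined by its valency, 5 or 6, so colours are preserved by
  every covering; see \<open>ribbon_covering_card_vertex\<close>.
\<close>

definition ribbon_covering :: "('b \<Rightarrow> 'a) \<Rightarrow> 'b ribbon_graph \<Rightarrow> 'a ribbon_graph \<Rightarrow> bool" where
  "ribbon_covering f H G \<longleftrightarrow>
     f ` darts H = darts G \<and>
     (\<forall>d\<in>darts H. f (opp H d) = opp G (f d) \<and> f (rot H d) = rot G (f d) \<and>
        bij_betw f (vertex H d) (vertex G (f d)))"

definition has_degree :: "('b \<Rightarrow> 'a) \<Rightarrow> 'b ribbon_graph \<Rightarrow> 'a ribbon_graph \<Rightarrow> nat \<Rightarrow> bool" where
  "has_degree f H G D \<longleftrightarrow> (\<forall>d\<in>darts G. card {e \<in> darts H. f e = d} = D)"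

text \<open>\<open>branched_cover D P' P\<close>: the pattern \<open>P'\<close> is a branched cover of \<open>P\<close> of degree \<open>D\<close>.
  Existence statements about patterns may use the dart type \<open>nat\<close> without loss of generality, as every
  finite ribbon graph is isomorphic to one on \<open>nat\<close>.\<close>

definition branched_cover :: "nat \<Rightarrow> 'b ribbon_graph \<Rightarrow> 'a ribbon_graph \<Rightarrow> bool" where
  "branched_cover D P' P \<longleftrightarrow>
     football_pattern P' \<and> football_pattern P \<and>
     (\<exists>f. ribbon_covering f (dual P') (dual P) \<and> has_degree f (dual P') (dual P) D)"

lemma ribbon_covering_card_vertex:
  assumes "ribbon_covering f H G" "d \<in> darts H"
  shows "card (vertex H d) = card (vertex G (f d))"
  using assms by (auto simp: ribbon_covering_def dest: bij_betw_same_card)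

lemma vertex_dual: "vertex (dual M) d = face M d"
  by (simp add: vertex_def face_def dual_def)

lemma orbit_subset_closed:
  assumes "bij_betw g S S" "d \<in> S"
  shows "orbit g d \<subseteq> S"
proof
  fix x assume "x \<in> orbit g d"
  then show "x \<in> S"
    by induction (use assms in \<open>auto simp: bij_betw_def\<close>)
qed

lemma orbit_image_commute:
  assumes "bij_betw g S S" "\<And>x. x \<in> S \<Longrightarrow> f (g x) = h (f x)" "d \<in> S"
  shows "f ` orbit g d = orbit h (f d)"
proof
  show "f ` orbit g d \<subseteq> orbit h (f d)"
  proof clarify
    fix x assume "x \<in> orbit g d"
    then show "f x \<in> orbit h (f d)"
    proof induction
      case base
      then show ?case using assms(2,3) by (simp add: orbit.base)
    next
      case (step y)
      then have "y \<in> S" using orbit_subset_closed[OF assms(1,3)] by blast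
      then show ?case using step.IH assms(2) by (simp add: orbit.step)
    qed
  qed
  show "orbit h (f d) \<subseteq> f ` orbit g d"
  proof
    fix y assume "y \<in> orbit h (f d)"
    then show "y \<in> f ` orbit g d"
    proof induction
      case base
      then show ?case using assms(2)[OF assms(3)] by (metis image_eqI orbit.base)
    next
      case (step y)
      then obtain x where x: "x \<in> orbit g d" "y = f x" by blast
      then have "x \<in> S" using orbit_subset_closed[OF assms(1,3)] by blast
      then show ?case using x assms(2) by (metis image_eqI orbit.step)
    qed
  qed
qed

lemma bij_face_next:
  assumes "surface_map M"
  shows "bij_betw (face_next M) (darts M) (darts M)"
proof -
  have "bij_betw (opp M) (darts M) (darts M)"
    using assms by (intro bij_betwI[where g = "opp M"]) (auto simp: surface_map_def)
  from bij_betw_trans[OF this, of "rot M" "darts M"] show ?thesis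
    using assms by (simp add: surface_map_def face_next_def[abs_def] comp_def)
qed

text \<open>
  In terms of the patterns themselves: a covering of the duals is an orientation-preserving,
  cellular branched covering that maps faces of \<open>P'\<close> to faces of \<open>P\<close> with the same number of sides,
  i.e. without branch points in the faces.  There is no branching inside edges because \<open>opp\<close> has
  no fixed points.
\<close>

lemma ribbon_covering_dual_iff:
  assumes "surface_map M'" "surface_map M"
  shows "ribbon_covering f (dual M') (dual M) \<longleftrightarrow>
     f ` darts M' = darts M \<and>
     (\<forall>d\<in>darts M'. f (opp M' d) = opp M (f d) \<and> f (rot M' d) = rot M (f d) \<and>
        card (face M' d) = card (face M (f d)))"
    (is "?L \<longleftrightarrow> ?R")
proof -
  have opp': "opp M' d \<in> darts M'" "opp M' (opp M' d) = d" if "d \<in> darts M'" for d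
    using assms(1) that by (auto simp: surface_map_def)
  note bij = bij_face_next[OF assms(1)]
  have fin: "finite (face M' d)" if "d \<in> darts M'" for d
    using orbit_subset_closed[OF bij that] assms(1)
    by (auto simp: face_def surface_map_def intro: finite_subset)
  have opp2: "opp M (opp M d) = d" if "d \<in> darts M" for d
    using assms(2) that by (auto simp: surface_map_def)
  show ?thesis
  proof
    assume L: ?L
    then have sur: "f ` darts M' = darts M"
      and o: "\<And>d. d \<in> darts M' \<Longrightarrow> f (opp M' d) = opp M (f d)"
      and r: "\<And>d. d \<in> darts M' \<Longrightarrow> f (face_next M' d) = face_next M (f d)"
      by (auto simp: ribbon_covering_def dual_def)
    have "f (rot M' d) = rot M (f d)" if d: "d \<in> darts M'" for d
    proof -
      have "f (rot M' d) = f (face_next M' (opp M' d))"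
        using d by (simp add: face_next_def opp')
      also have "\<dots> = rot M (opp M (opp M (f d)))"
        using r[OF opp'(1)[OF d]] o[OF d] by (simp add: face_next_def)
      also have "opp M (opp M (f d)) = f d"
        using sur d by (intro opp2) blast
      finally show ?thesis .
    qed
    moreover have "card (face M' d) = card (face M (f d))" if "d \<in> darts M'" for d
      using ribbon_covering_card_vertex[OF L, of d] that by (simp add: vertex_dual) (simp add: dual_def)
    ultimately show ?R using sur o by blast
  next
    assume R: ?R
    then have comm: "f (face_next M' d) = face_next M (f d)" if "d \<in> darts M'" for d
      using that opp'(1) by (simp add: face_next_def)
    have "bij_betw f (face M' d) (face M (f d))" if d: "d \<in> darts M'" for d
    proof -
      have img: "f ` face M' d = face M (f d)"
        unfolding face_def using orbit_image_commute[of "face_next M'" "darts M'" f "face_next M"] bij comm d by blast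
      then have "inj_on f (face M' d)"
        using R d by (intro eq_card_imp_inj_on fin) auto
      then show ?thesis using img by (simp add: bij_betw_def)
    qed
    then show ?L
      using R comm unfolding ribbon_covering_def vertex_dual by (simp add: dual_def)
  qed
qed

text \<open>
  The neighbours of each of the 12 vertices of the icosahedron, in clockwise order as seen
  from outside: \<open>0\<close> is the north pole, \<open>1\<close> to \<open>5\<close> and \<open>6\<close> to \<open>10\<close> are the
  upper and the lower ring, \<open>11\<close> is the south pole.
\<close>

definition icosahedron_nbs :: "nat list list" where
  "icosahedron_nbs =
    [[1, 2, 3, 4, 5],
     [0, 5, 10, 6, 2], [0, 1, 6, 7, 3], [0, 2, 7, 8, 4], [0, 3, 8, 9, 5], [0, 4, 9, 10, 1],
     [1, 10, 11, 7, 2], [2, 6, 11, 8, 3], [3, 7, 11, 9, 4], [4, 8, 11, 10, 5], [5, 9, 11, 6, 1],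
     [10, 9, 8, 7, 6]]"

fun cyclic_next :: "'a list \<Rightarrow> 'a \<Rightarrow> 'a" where
  "cyclic_next xs x = (case dropWhile (\<lambda>y. y \<noteq> x) (xs @ xs) of _ # y # _ \<Rightarrow> y | _ \<Rightarrow> x)"

definition icosahedron :: "(nat \<times> nat) ribbon_graph" where
  "icosahedron =
    \<lparr>darts = (SIGMA u:{..<12}. set (icosahedron_nbs ! u)),
     opp = (\<lambda>(u, v). (v, u)),
     rot = (\<lambda>(u, v). (u, cyclic_next (icosahedron_nbs ! u) v))\<rparr>"

text \<open>
  Truncation cuts off every vertex of a map: there is one new vertex on each dart \<open>d\<close>, near its
  origin.  If the origin of \<open>d\<close> has valency at least 3, the three darts at the new vertex are,
  clockwise: \<open>Along d\<close>, along \<open>d\<close> towards the new vertex on \<open>opp d\<close>; \<open>Succ d\<close>, towards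
  the new vertex on the dart following \<open>d\<close> clockwise; and \<open>Pred d\<close>, towards the new vertex on the
  dart preceding \<open>d\<close>.
\<close>

datatype 'a trunc_dart = Along 'a | Succ 'a | Pred 'a

definition truncation :: "'a ribbon_graph \<Rightarrow> 'a trunc_dart ribbon_graph" where
  "truncation M =
    \<lparr>darts = Along ` darts M \<union> Succ ` darts M \<union> Pred ` darts M,
     opp = (\<lambda>x. case x of
         Along d \<Rightarrow> Along (opp M d)
       | Succ d \<Rightarrow> Pred (rot M d)
       | Pred d \<Rightarrow> Succ (inv_into (darts M) (rot M) d)),
     rot = (\<lambda>x. case x of
         Along d \<Rightarrow> Succ d
       | Succ d \<Rightarrow> Pred d
       | Pred d \<Rightarrow> Along d)\<rparr>"

definition truncated_icosahedron :: "(nat \<times> nat) trunc_dart ribbon_graph" where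
  "truncated_icosahedron = truncation icosahedron"

lemma card_orbit_iter:
  assumes "distinct (map (\<lambda>k. (f ^^ k) x) [0..<n])" "(f ^^ n) x = x" "n > 0"
  shows "card (orbit f x) = n"
proof -
  have *: "(f ^^ m) x = (f ^^ (m mod n)) x" for m
    using assms(2) by (simp add: funpow_mod_eq)
  have "orbit f x = (\<lambda>k. (f ^^ k) x) ` {0..<n}"
  proof (intro equalityI subsetI)
    fix y assume "y \<in> orbit f x"
    then obtain m where "y = (f ^^ m) x" by (auto simp: orbit_altdef)
    then have "y = (f ^^ (m mod n)) x" using * by simp
    then show "y \<in> (\<lambda>k. (f ^^ k) x) ` {0..<n}" using assms(3) by auto
  next
    fix y assume "y \<in> (\<lambda>k. (f ^^ k) x) ` {0..<n}"
    then obtain k where "y = (f ^^ k) x" by auto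
    then have "y = (f ^^ (k + n)) x" using assms(2) by (simp add: funpow_add)
    then show "y \<in> orbit f x" using assms(3) by (auto simp: orbit_altdef)
  qed
  also have "\<dots> = set (map (\<lambda>k. (f ^^ k) x) [0..<n])" by simp
  also have "card \<dots> = n" using distinct_card[OF assms(1)] by simp
  finally show ?thesis .
qed

lemma card_orbit_3:
  assumes "distinct [x, f x, f (f x)]" "f (f (f x)) = x"
  shows "card (orbit f x) = 3"
  by (rule card_orbit_iter) (use assms in \<open>simp_all add: upt_rec numeral_eq_Suc\<close>)

lemma card_orbit_5:
  assumes "distinct [x, f x, f (f x), f (f (f x)), f (f (f (f x)))]" "f (f (f (f (f x)))) = x"
  shows "card (orbit f x) = 5"
  by (rule card_orbit_iter) (use assms in \<open>simp_all add: upt_rec numeral_eq_Suc\<close>)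

lemma card_orbit_6:
  assumes "distinct [x, f x, f (f x), f (f (f x)), f (f (f (f x))), f (f (f (f (f x))))]"
    "f (f (f (f (f (f x))))) = x"
  shows "card (orbit f x) = 6"
  by (rule card_orbit_iter) (use assms in \<open>simp_all add: upt_rec numeral_eq_Suc\<close>)

lemma card_orbit_image:
  assumes "finite S" "bij_betw g S S" "\<And>x. x \<in> S \<Longrightarrow> card (orbit g x) = k"
  shows "k * card (orbit g ` S) = card S"
proof -
  have sub: "orbit g x \<subseteq> S" if "x \<in> S" for x
    using orbit_subset_closed[OF assms(2) that] .
  have self: "x \<in> orbit g x" if "x \<in> S" for x
  proof -
    have inj: "inj_on g S" and gS: "g ` S = S" using assms(2) by (auto simp: bij_betw_def)
    have it: "orbit g y \<subseteq> g ` orbit g y \<union> {g y}" for y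
      by (auto elim: orbit.cases)
    show ?thesis
    proof (rule ccontr)
      assume n: "x \<notin> orbit g x"
      have "orbit g x \<noteq> {}" by (auto intro: orbit.base)
      have "g ` insert x (orbit g x) \<subseteq> orbit g x" by (auto intro: orbit.intros)
      moreover have "finite (orbit g x)" using sub[OF that] assms(1) finite_subset by blast
      moreover have "inj_on g (insert x (orbit g x))"
        using inj sub[OF that] that by (meson inj_on_subset insert_subset)
      ultimately have "card (insert x (orbit g x)) \<le> card (orbit g x)"
        using card_inj_on_le by blast
      then show False using n \<open>finite (orbit g x)\<close> by simp
    qed
  qed
  have disj: "orbit g x = orbit g y" if "z \<in> orbit g x" "z \<in> orbit g y" "x \<in> S" "y \<in> S" for x y z
  proof -
    have "orbit g v = orbit g z" if "z \<in> orbit g v" "v \<in> S" for v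
      using that orbit_swap[OF self[OF that(2)] that(1)] orbit_trans[of _ g] by blast
    then show ?thesis using that by metis
  qed
  have un: "\<Union> (orbit g ` S) = S" using sub self by blast
  show ?thesis
  proof -
    have "k * card (orbit g ` S) = card (\<Union> (orbit g ` S))"
    proof (rule card_partition)
      show "finite (orbit g ` S)" "finite (\<Union> (orbit g ` S))" using assms(1) un by simp_all
      show "card c = k" if "c \<in> orbit g ` S" for c using that assms(3) by blast
      show "c1 \<inter> c2 = {}" if "c1 \<in> orbit g ` S" "c2 \<in> orbit g ` S" "c1 \<noteq> c2" for c1 c2
        using that disj by blast
    qed
    then show ?thesis using un by simp
  qed
qed

lemma ico_darts: "darts icosahedron = set (concat (map (\<lambda>u. map (Pair u) (icosahedron_nbs ! u)) [0,1,2,3,4,5,6,7,8,9,10,11]))"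
  by (auto simp: icosahedron_def numeral_eq_Suc less_Suc_eq)

lemma opp_ico: "opp icosahedron (u, v) = (v, u)"
  by (simp add: icosahedron_def)

lemma rot_ico:
  "rot icosahedron (0, 1) = (0, 2)"
  "rot icosahedron (0, 2) = (0, 3)"
  "rot icosahedron (0, 3) = (0, 4)"
  "rot icosahedron (0, 4) = (0, 5)"
  "rot icosahedron (0, 5) = (0, 1)"
  "rot icosahedron (1, 0) = (1, 5)"
  "rot icosahedron (1, 5) = (1, 10)"
  "rot icosahedron (1, 10) = (1, 6)"
  "rot icosahedron (1, 6) = (1, 2)"
  "rot icosahedron (1, 2) = (1, 0)"
  "rot icosahedron (2, 0) = (2, 1)"
  "rot icosahedron (2, 1) = (2, 6)"
  "rot icosahedron (2, 6) = (2, 7)"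
  "rot icosahedron (2, 7) = (2, 3)"
  "rot icosahedron (2, 3) = (2, 0)"
  "rot icosahedron (3, 0) = (3, 2)"
  "rot icosahedron (3, 2) = (3, 7)"
  "rot icosahedron (3, 7) = (3, 8)"
  "rot icosahedron (3, 8) = (3, 4)"
  "rot icosahedron (3, 4) = (3, 0)"
  "rot icosahedron (4, 0) = (4, 3)"
  "rot icosahedron (4, 3) = (4, 8)"
  "rot icosahedron (4, 8) = (4, 9)"
  "rot icosahedron (4, 9) = (4, 5)"
  "rot icosahedron (4, 5) = (4, 0)"
  "rot icosahedron (5, 0) = (5, 4)"
  "rot icosahedron (5, 4) = (5, 9)"
  "rot icosahedron (5, 9) = (5, 10)"
  "rot icosahedron (5, 10) = (5, 1)"
  "rot icosahedron (5, 1) = (5, 0)"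
  "rot icosahedron (6, 1) = (6, 10)"
  "rot icosahedron (6, 10) = (6, 11)"
  "rot icosahedron (6, 11) = (6, 7)"
  "rot icosahedron (6, 7) = (6, 2)"
  "rot icosahedron (6, 2) = (6, 1)"
  "rot icosahedron (7, 2) = (7, 6)"
  "rot icosahedron (7, 6) = (7, 11)"
  "rot icosahedron (7, 11) = (7, 8)"
  "rot icosahedron (7, 8) = (7, 3)"
  "rot icosahedron (7, 3) = (7, 2)"
  "rot icosahedron (8, 3) = (8, 7)"
  "rot icosahedron (8, 7) = (8, 11)"
  "rot icosahedron (8, 11) = (8, 9)"
  "rot icosahedron (8, 9) = (8, 4)"
  "rot icosahedron (8, 4) = (8, 3)"
  "rot icosahedron (9, 4) = (9, 8)"
  "rot icosahedron (9, 8) = (9, 11)"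
  "rot icosahedron (9, 11) = (9, 10)"
  "rot icosahedron (9, 10) = (9, 5)"
  "rot icosahedron (9, 5) = (9, 4)"
  "rot icosahedron (10, 5) = (10, 9)"
  "rot icosahedron (10, 9) = (10, 11)"
  "rot icosahedron (10, 11) = (10, 6)"
  "rot icosahedron (10, 6) = (10, 1)"
  "rot icosahedron (10, 1) = (10, 5)"
  "rot icosahedron (11, 10) = (11, 9)"
  "rot icosahedron (11, 9) = (11, 8)"
  "rot icosahedron (11, 8) = (11, 7)"
  "rot icosahedron (11, 7) = (11, 6)"
  "rot icosahedron (11, 6) = (11, 10)"
  by (simp_all add: icosahedron_def icosahedron_nbs_def)

lemma ico_orbits:
  assumes "d \<in> darts icosahedron"
  defines "r \<equiv> rot icosahedron" and "n \<equiv> face_next icosahedron"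
  shows "r d \<in> darts icosahedron" "opp icosahedron d \<in> darts icosahedron"
    "opp icosahedron d \<noteq> d" "opp icosahedron (opp icosahedron d) = d"
    "distinct [d, r d, r (r d), r (r (r d)), r (r (r (r d)))]" "r (r (r (r (r d)))) = d"
    "distinct [d, n d, n (n d)]" "n (n (n d)) = d"
proof -
  have *: "\<forall>d\<in>darts icosahedron. r d \<in> darts icosahedron \<and> opp icosahedron d \<in> darts icosahedron \<and>
     opp icosahedron d \<noteq> d \<and> opp icosahedron (opp icosahedron d) = d \<and>
     distinct [d, r d, r (r d), r (r (r d)), r (r (r (r d)))] \<and> r (r (r (r (r d)))) = d \<and>
     distinct [d, n d, n (n d)] \<and> n (n (n d)) = d"
    by (simp add: ico_darts icosahedron_nbs_def rot_ico opp_ico r_def n_def face_next_def del: One_nat_def)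
  note * = *[rule_format, OF assms(1)]
  show "r d \<in> darts icosahedron" "opp icosahedron d \<in> darts icosahedron"
    "opp icosahedron d \<noteq> d" "opp icosahedron (opp icosahedron d) = d"
    "distinct [d, r d, r (r d), r (r (r d)), r (r (r (r d)))]" "r (r (r (r (r d)))) = d"
    "distinct [d, n d, n (n d)]" "n (n (n d)) = d"
    using * by simp_all
qed

lemma finite_ico: "finite (darts icosahedron)" and card_ico: "card (darts icosahedron) = 60"
proof -
  show "finite (darts icosahedron)" by (simp add: icosahedron_def)
  have "distinct (concat (map (\<lambda>u. map (Pair u) (icosahedron_nbs ! u)) [0,1,2,3,4,5,6,7,8,9,10,11]))"
    by (simp add: icosahedron_nbs_def del: One_nat_def)
  from distinct_card[OF this] show "card (darts icosahedron) = 60"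
    unfolding ico_darts by (simp add: icosahedron_nbs_def)
qed

lemma connected_ico:
  assumes "d \<in> darts icosahedron" "e \<in> darts icosahedron"
  shows "(d, e) \<in> (dart_step icosahedron)\<^sup>*"
proof -
  let ?R = "(dart_step icosahedron)\<^sup>*"
  have r: "(x, rot icosahedron x) \<in> ?R" "(x, opp icosahedron x) \<in> ?R" if "x \<in> darts icosahedron" for x
    using that by (auto simp: dart_step_def)
  have sym: "(y, x) \<in> ?R" if "(x, y) \<in> ?R" for x y
    using that
  proof induction
    case (step y z)
    then have y: "y \<in> darts icosahedron" and z: "z = opp icosahedron y \<or> z = rot icosahedron y"
      by (auto simp: dart_step_def)
    have "(z, y) \<in> ?R"
      using z
    proof
      assume "z = opp icosahedron y"
      then show ?thesis using r(2)[of z] ico_orbits[OF y] by simp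
    next
      assume z: "z = rot icosahedron y"
      let ?r = "rot icosahedron"
      note c = ico_orbits(1)[OF y] ico_orbits(1)[OF ico_orbits(1)[OF y]]
      note c = c ico_orbits(1)[OF c(2)]
      note c = c ico_orbits(1)[OF c(3)]
      have "(?r y, ?r (?r (?r (?r (?r y))))) \<in> ?R"
        using c r(1) by (meson rtrancl_trans)
      then show ?thesis using z ico_orbits(6)[OF y] by simp
    qed
    then show ?case using step.IH by (rule rtrancl_trans)
  qed simp
  have nb: "((u, v), (u, w)) \<in> ?R" if "(u, v) \<in> darts icosahedron" "(u, w) \<in> darts icosahedron" for u v w
  proof -
    let ?r = "rot icosahedron"
    note y = that(1)
    note c = y ico_orbits(1)[OF y] ico_orbits(1)[OF ico_orbits(1)[OF y]]
    note c = c ico_orbits(1)[OF c(3)]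
    note c = c ico_orbits(1)[OF c(4)]
    have R: "(x, ?r x) \<in> ?R" if "x \<in> darts icosahedron" for x using r that by simp
    have a: "((u,v), (u,v)) \<in> ?R" by simp
    note a1 = rtrancl_trans[OF a R[OF c(1)]]
    note a2 = rtrancl_trans[OF a1 R[OF c(2)]]
    note a3 = rtrancl_trans[OF a2 R[OF c(3)]]
    note a4 = rtrancl_trans[OF a3 R[OF c(4)]]
    have "\<forall>(u, v)\<in>darts icosahedron.
       Pair u ` set (icosahedron_nbs ! u) \<subseteq> {(u, v), ?r (u, v), ?r (?r (u, v)), ?r (?r (?r (u, v))), ?r (?r (?r (?r (u, v))))}"
      by (simp add: ico_darts icosahedron_nbs_def rot_ico del: One_nat_def)
    moreover have "w \<in> set (icosahedron_nbs ! u)" using that(2) by (simp add: icosahedron_def)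
    ultimately have "(u, w) \<in> {(u, v), ?r (u, v), ?r (?r (u, v)), ?r (?r (?r (u, v))), ?r (?r (?r (?r (u, v))))}"
      using y by blast
    then show ?thesis using a a1 a2 a3 a4 by auto
  qed
  have st: "((u, v), (v, w)) \<in> ?R" if "(u, v) \<in> darts icosahedron" "(v, w) \<in> darts icosahedron" for u v w
    using r(2)[OF that(1)] nb[of v u w] ico_orbits(2)[OF that(1)] that(2)
    by (auto simp: opp_ico intro: rtrancl_trans)
  have D: "(0, i) \<in> darts icosahedron" if "i \<in> {1,2,3,4,5}" for i
    using that by (auto simp: icosahedron_def icosahedron_nbs_def)
  have base: "((0, 1), x) \<in> ?R" if "x \<in> darts icosahedron" for x
  proof -
    obtain u w where x: "x = (u, w)" by fastforce
    have "\<forall>u\<in>{0,1,2,3,4,5,6,7,8,9,10,11}. u = 0 \<or> (0, u) \<in> darts icosahedron \<or>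
        (\<exists>i\<in>{1,2,3,4,5}. (i, u) \<in> darts icosahedron) \<or> (6, u) \<in> darts icosahedron"
      by (simp add: icosahedron_def icosahedron_nbs_def del: One_nat_def)
    moreover have "u \<in> {0,1,2,3,4,5,6,7,8,9,10,11}"
      using that x by (auto simp: icosahedron_def numeral_eq_Suc less_Suc_eq)
    ultimately have "u = 0 \<or> (0, u) \<in> darts icosahedron \<or>
        (\<exists>i\<in>{1,2,3,4,5}. (i, u) \<in> darts icosahedron) \<or> (6, u) \<in> darts icosahedron"
      by (rule bspec)
    moreover have "(0, 1) \<in> darts icosahedron" "(1, 6) \<in> darts icosahedron"
      by (simp_all add: icosahedron_def icosahedron_nbs_def)
    ultimately consider "u = 0"  | "(0, u) \<in> darts icosahedron"
      | i where "i\<in>{1,2,3,4,5}" "(i, u) \<in> darts icosahedron"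
      | "(0, 1) \<in> darts icosahedron" "(1, 6) \<in> darts icosahedron" "(6, u) \<in> darts icosahedron"
      by blast
    then show ?thesis
    proof cases
      case 1 then show ?thesis using nb D[of 1] that x by auto
    next
      case 2 then show ?thesis using nb[OF D[of 1]] st that x by (meson insertI1 rtrancl_trans)
    next
      case 3 then show ?thesis using nb[OF D[of 1] D[of i]] st[OF D[of i]] st[of i u w] that x
        by (meson insertI1 rtrancl_trans)
    next
      case 4 then show ?thesis using st[of 0 1 6] st[of 1 6 u] st[of 6 u w] that x
        by (meson rtrancl_trans)
    qed
  qed
  show ?thesis using base[OF assms(1)] base[OF assms(2)] sym rtrancl_trans by metis
qed

lemma surface_map_ico: "surface_map icosahedron"
proof -
  have "rot icosahedron ` darts icosahedron = darts icosahedron"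
  proof
    show "rot icosahedron ` darts icosahedron \<subseteq> darts icosahedron" using ico_orbits(1) by blast
    show "darts icosahedron \<subseteq> rot icosahedron ` darts icosahedron"
      by (metis (no_types, lifting) ico_orbits(1,6) image_eqI subsetI)
  qed
  then have "bij_betw (rot icosahedron) (darts icosahedron) (darts icosahedron)"
    using finite_ico by (simp add: bij_betw_def finite_surj_inj)
  then show ?thesis
    unfolding surface_map_def using finite_ico card_ico ico_orbits(2,3,4) connected_ico by force
qed

lemma truncation_simps:
  "darts (truncation M) = Along ` darts M \<union> Succ ` darts M \<union> Pred ` darts M"
  "rot (truncation M) (Along d) = Succ d"
  "rot (truncation M) (Succ d) = Pred d"
  "rot (truncation M) (Pred d) = Along d"
  "opp (truncation M) (Along d) = Along (opp M d)"
  "opp (truncation M) (Succ d) = Pred (rot M d)"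
  "opp (truncation M) (Pred d) = Succ (inv_into (darts M) (rot M) d)"
  "face_next (truncation M) (Along d) = Succ (opp M d)"
  "face_next (truncation M) (Succ d) = Along (rot M d)"
  "face_next (truncation M) (Pred d) = Pred (inv_into (darts M) (rot M) d)"
  by (simp_all add: truncation_def face_next_def)

lemma surface_map_truncation:
  assumes "surface_map M"
  shows "surface_map (truncation M)"
proof -
  let ?T = "truncation M" and ?p = "inv_into (darts M) (rot M)"
  let ?R = "(dart_step ?T)\<^sup>*"
  have M: "finite (darts M)" "darts M \<noteq> {}" "bij_betw (rot M) (darts M) (darts M)"
    "\<And>d. d \<in> darts M \<Longrightarrow> opp M d \<in> darts M \<and> opp M d \<noteq> d \<and> opp M (opp M d) = d"
    "\<And>d e. d \<in> darts M \<Longrightarrow> e \<in> darts M \<Longrightarrow> (d, e) \<in> (dart_step M)\<^sup>*"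
    using assms by (auto simp: surface_map_def)
  have p: "?p d \<in> darts M" "rot M (?p d) = d" "?p (rot M d) = d" "rot M d \<in> darts M" if "d \<in> darts M" for d
    using that M(3) bij_betw_inv_into_right[OF M(3)] bij_betw_inv_into_left[OF M(3)]
      bij_betwE[OF M(3)] bij_betwE[OF bij_betw_inv_into[OF M(3)]] by auto
  have bij: "bij_betw (rot ?T) (darts ?T) (darts ?T)"
    by (rule bij_betwI[where g = "\<lambda>x. rot ?T (rot ?T x)"]) (auto simp: truncation_simps)
  have R1: "(Along d, Succ d) \<in> ?R" "(Succ d, Pred d) \<in> ?R" "(Pred d, Along d) \<in> ?R"
    "(Along d, Along (opp M d)) \<in> ?R" "(Succ d, Pred (rot M d)) \<in> ?R" if "d \<in> darts M" for d
    using that by (auto simp: dart_step_def truncation_simps intro!: r_into_rtrancl)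
  have R2: "(Along d, Along e) \<in> ?R" if "(d, e) \<in> (dart_step M)\<^sup>*" for d e
    using that
  proof induction
    case (step y z)
    then have y: "y \<in> darts M" and z: "z = opp M y \<or> z = rot M y" by (auto simp: dart_step_def)
    then have "(Along y, Along z) \<in> ?R"
      using R1(4)[OF y] R1(1,5)[OF y] R1(3)[OF p(4)[OF y]] by (auto intro: rtrancl_trans)
    then show ?case using step.IH by (auto intro: rtrancl_trans)
  qed simp
  have R3: "\<exists>d\<in>darts M. (x, Along d) \<in> ?R \<and> (Along d, x) \<in> ?R" if "x \<in> darts ?T" for x
  proof -
    have "(Succ d, Along d) \<in> ?R" "(Along d, Pred d) \<in> ?R" if "d \<in> darts M" for d
      using R1(1-3)[OF that] by (auto intro: rtrancl_trans)
    moreover obtain d where d: "d \<in> darts M" "x \<in> {Along d, Succ d, Pred d}"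
      using \<open>x \<in> darts ?T\<close> by (auto simp: truncation_simps)
    ultimately show ?thesis using R1(1,3) by (intro bexI[of _ d]) auto
  qed
  have "(x, y) \<in> ?R" if "x \<in> darts ?T" "y \<in> darts ?T" for x y
    using R3[OF that(1)] R3[OF that(2)] R2[OF M(5)] by (meson rtrancl_trans)
  moreover have "opp ?T x \<in> darts ?T \<and> opp ?T x \<noteq> x \<and> opp ?T (opp ?T x) = x" if "x \<in> darts ?T" for x
    using that M(4) p by (auto simp: truncation_simps)
  ultimately show ?thesis
    using bij M(1,2) by (simp add: surface_map_def) (simp add: truncation_simps)
qed

lemma truncated_icosahedron_orbits:
  assumes "d \<in> darts icosahedron"
  shows "card (face truncated_icosahedron (Along d)) = 6"
    "card (face truncated_icosahedron (Succ d)) = 6"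
    "card (face truncated_icosahedron (Pred d)) = 5"
    "card (vertex truncated_icosahedron (Along d)) = 3"
    "card (vertex truncated_icosahedron (Succ d)) = 3"
    "card (vertex truncated_icosahedron (Pred d)) = 3"
proof -
  let ?D = "darts icosahedron" and ?r = "rot icosahedron" and ?o = "opp icosahedron"
  let ?n = "face_next icosahedron" and ?p = "inv_into (darts icosahedron) (rot icosahedron)"
  note I = ico_orbits
  have n: "?r (?o x) = ?n x" for x by (simp add: face_next_def)
  have along: "card (orbit (face_next (truncation icosahedron)) (Along d)) = 6" if "d \<in> ?D" for d
  proof (rule card_orbit_6)
    have D: "d \<in> ?D" "?n d \<in> ?D" "?n (?n d) \<in> ?D" using that I(1,2) by (auto simp: face_next_def)
    let ?F = "face_next (truncation icosahedron)" and ?x = "Along d"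
    show "?F (?F (?F (?F (?F (?F ?x))))) = ?x"
      using I(8)[OF that] by (simp add: truncation_simps n)
    have "?o x \<noteq> ?o y" if "x \<in> ?D" "y \<in> ?D" "x \<noteq> y" for x y
      using that I(4) by metis
    then show "distinct [?x, ?F ?x, ?F (?F ?x), ?F (?F (?F ?x)), ?F (?F (?F (?F ?x))),
        ?F (?F (?F (?F (?F ?x))))]"
      using I(7)[OF that] D by (simp add: truncation_simps n)
  qed
  then show "card (face truncated_icosahedron (Along d)) = 6"
    using assms by (simp add: face_def truncated_icosahedron_def)
  have bij: "bij_betw (face_next (truncation icosahedron)) (darts (truncation icosahedron)) (darts (truncation icosahedron))"
    by (rule bij_face_next[OF surface_map_truncation[OF surface_map_ico]])
  show "card (face truncated_icosahedron (Succ d)) = 6"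
  proof -
    let ?F = "face_next (truncation icosahedron)"
    let ?e = "?o d"
    have e: "?e \<in> ?D" "?o ?e = d" using assms I by auto
    have s: "Succ d = ?F (Along ?e)" using e by (simp add: truncation_simps)
    have "?F (?F (?F (?F (?F (?F (Along ?e)))))) = Along ?e"
      using I(8)[OF e(1)] by (simp add: truncation_simps n)
    then have "Along ?e = (?F ^^ 6) (Along ?e)" by (simp add: numeral_eq_Suc)
    then have self: "Along ?e \<in> orbit ?F (Along ?e)"
      by (metis (mono_tags, lifting) mem_Collect_eq orbit_altdef zero_less_numeral)
    have "orbit ?F (Succ d) = orbit ?F (Along ?e)"
    proof
      have "Succ d \<in> orbit ?F (Along ?e)" using s by (simp add: orbit.base)
      then show "orbit ?F (Succ d) \<subseteq> orbit ?F (Along ?e)" "orbit ?F (Along ?e) \<subseteq> orbit ?F (Succ d)"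
        using orbit_swap[OF self] orbit_trans[of _ ?F] by blast+
    qed
    then show ?thesis using along[OF e(1)] by (simp add: face_def truncated_icosahedron_def)
  qed
  show "card (face truncated_icosahedron (Pred d)) = 5"
  proof -
    have D: "?r x \<in> ?D" if "x \<in> ?D" for x using I(1) that .
    have p: "?p (?r x) = x" if "x \<in> ?D" for x
      using surface_map_ico that by (auto simp: surface_map_def intro: bij_betw_inv_into_left)
    note d1 = D[OF assms]
    note d2 = D[OF d1]
    note d3 = D[OF d2]
    note d4 = D[OF d3]
    have p0: "?p d = ?r (?r (?r (?r d)))" using p[OF d4] I(6)[OF assms] by simp
    show ?thesis
      unfolding face_def truncated_icosahedron_def
      by (rule card_orbit_5)
        (use I(5)[OF assms] p0 p[OF assms] p[OF d1] p[OF d2] p[OF d3] in \<open>auto simp: truncation_simps\<close>)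
  qed
  show "card (vertex truncated_icosahedron (Along d)) = 3"
    "card (vertex truncated_icosahedron (Succ d)) = 3"
    "card (vertex truncated_icosahedron (Pred d)) = 3"
    unfolding vertex_def truncated_icosahedron_def
    by (rule card_orbit_3; simp add: truncation_simps)+
qed

lemma card_darts_truncated_icosahedron:
  "card (Along ` darts icosahedron \<union> Succ ` darts icosahedron) = 120"
  "card (Pred ` darts icosahedron) = 60"
  "card (darts truncated_icosahedron) = 180"
proof -
  have c: "card (Along ` darts icosahedron) = 60" "card (Succ ` darts icosahedron) = 60"
    "card (Pred ` darts icosahedron) = 60"
    using card_ico by (auto simp: card_image inj_on_def)
  show "card (Pred ` darts icosahedron) = 60" by (rule c)
  show *: "card (Along ` darts icosahedron \<union> Succ ` darts icosahedron) = 120"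
    using c by (subst card_Un_disjoint) (auto simp: finite_ico)
  show "card (darts truncated_icosahedron) = 180"
    unfolding truncated_icosahedron_def truncation_simps
    using c(3) * by (subst card_Un_disjoint) (auto simp: finite_ico)
qed

lemma football_pattern_truncated_icosahedron: "football_pattern truncated_icosahedron"
proof -
  let ?T = truncated_icosahedron
  note S = truncation_simps[of icosahedron, folded truncated_icosahedron_def]
  note O = truncated_icosahedron_orbits
  have p: "inv_into (darts icosahedron) (rot icosahedron) d \<in> darts icosahedron" if "d \<in> darts icosahedron" for d
    using that surface_map_ico bij_betwE[OF bij_betw_inv_into] by (fastforce simp: surface_map_def)
  have T: "surface_map ?T"
    unfolding truncated_icosahedron_def by (rule surface_map_truncation[OF surface_map_ico])
  have V: "\<forall>v\<in>vertices ?T. card v \<ge> 3" using O by (auto simp: vertices_def S)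
  have A: "\<forall>A\<in>faces ?T. pentagon ?T A \<or> hexagon ?T A"
    using O by (auto simp: faces_def pentagon_def hexagon_def S)
  have ph: "hexagon ?T (face ?T (Along d))" "hexagon ?T (face ?T (Succ d))" "pentagon ?T (face ?T (Pred d))"
    "\<not> pentagon ?T (face ?T (Along d))" "\<not> pentagon ?T (face ?T (Succ d))" "\<not> hexagon ?T (face ?T (Pred d))"
    if "d \<in> darts icosahedron" for d
    using O[OF that] that by (auto simp: pentagon_def hexagon_def faces_def S)
  have cases: thesis if "x \<in> darts ?T" "\<And>d. d \<in> darts icosahedron \<Longrightarrow> x \<in> {Along d, Succ d, Pred d} \<Longrightarrow> thesis"
    for x thesis
    using that by (auto simp: S)
  have B: "\<forall>d\<in>darts ?T. pentagon ?T (face ?T d) \<longrightarrow> hexagon ?T (face ?T (opp ?T d))"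
  proof
    fix x assume "x \<in> darts ?T"
    then obtain d where d: "d \<in> darts icosahedron" "x \<in> {Along d, Succ d, Pred d}" by (rule cases)
    then show "pentagon ?T (face ?T x) \<longrightarrow> hexagon ?T (face ?T (opp ?T x))"
      using ph[OF d(1)] ph[OF p[OF d(1)]] by (auto simp: S)
  qed
  have C: "\<forall>d\<in>darts ?T. hexagon ?T (face ?T d) \<longrightarrow>
        (pentagon ?T (face ?T (opp ?T d)) \<longleftrightarrow> hexagon ?T (face ?T (opp ?T (face_next ?T d))))"
  proof
    fix x assume "x \<in> darts ?T"
    then obtain d where d: "d \<in> darts icosahedron" "x \<in> {Along d, Succ d, Pred d}" by (rule cases)
    note I = ico_orbits(1,2)[OF d(1)]
    show "hexagon ?T (face ?T x) \<longrightarrow>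
        (pentagon ?T (face ?T (opp ?T x)) \<longleftrightarrow> hexagon ?T (face ?T (opp ?T (face_next ?T x))))"
      using d(2) ph[OF d(1)] ph[OF I(1)] ph[OF I(2)] ph[OF ico_orbits(2)[OF I(1)]] ph[OF ico_orbits(1)[OF I(2)]]
      by (auto simp: S)
  qed
  show ?thesis unfolding football_pattern_def using T V A B C by blast
qed

lemma truncated_icosahedron_counts:
  "card {A. pentagon truncated_icosahedron A} = 12"
  "card {A. hexagon truncated_icosahedron A} = 20"
  "\<forall>v\<in>vertices truncated_icosahedron. card v = 3"
  "euler_char truncated_icosahedron = 2"
proof -
  let ?T = truncated_icosahedron and ?D = "darts icosahedron"
  note S = truncation_simps[of icosahedron, folded truncated_icosahedron_def]
  note O = truncated_icosahedron_orbits
  have T: "surface_map ?T"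
    unfolding truncated_icosahedron_def by (rule surface_map_truncation[OF surface_map_ico])
  have p: "inv_into (darts icosahedron) (rot icosahedron) d \<in> darts icosahedron" if "d \<in> darts icosahedron" for d
    using that surface_map_ico bij_betwE[OF bij_betw_inv_into] by (fastforce simp: surface_map_def)
  have fin: "finite (darts ?T)" using T by (simp add: surface_map_def)
  have inj: "inj_on (face_next ?T) (darts ?T)" using bij_face_next[OF T] by (rule bij_betw_imp_inj_on)
  let ?P = "Pred ` ?D" and ?H = "Along ` ?D \<union> Succ ` ?D"
  have PH: "?P \<subseteq> darts ?T" "?H \<subseteq> darts ?T" by (auto simp: S)
  have bij: "bij_betw (face_next ?T) X X" if "X \<subseteq> darts ?T" "face_next ?T ` X \<subseteq> X" for X
  proof -
    have "inj_on (face_next ?T) X" using inj that(1) by (rule inj_on_subset)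
    moreover have "face_next ?T ` X = X"
      using that fin calculation by (intro endo_inj_surj) (auto intro: finite_subset)
    ultimately show ?thesis by (simp add: bij_betw_def)
  qed
  have bijP: "bij_betw (face_next ?T) ?P ?P"
    by (rule bij) (use p in \<open>auto simp: S\<close>)
  have bijH: "bij_betw (face_next ?T) ?H ?H"
    by (rule bij) (use ico_orbits(1,2) in \<open>auto simp: S\<close>)
  have f: "face ?T = orbit (face_next ?T)" by (simp add: face_def fun_eq_iff)
  have "5 * card (face ?T ` ?P) = 60"
    unfolding f card_darts_truncated_icosahedron(2)[symmetric]
    by (rule card_orbit_image[OF _ bijP]) (use O finite_ico in \<open>auto simp: f\<close>)
  moreover have "{A. pentagon ?T A} = face ?T ` ?P"
    using O by (auto simp: pentagon_def faces_def S)
  ultimately show 12: "card {A. pentagon ?T A} = 12" by simp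
  have "6 * card (face ?T ` ?H) = 120"
    unfolding f card_darts_truncated_icosahedron(1)[symmetric]
    by (rule card_orbit_image[OF _ bijH]) (use O finite_ico in \<open>auto simp: f\<close>)
  moreover have "{A. hexagon ?T A} = face ?T ` ?H"
    using O by (auto simp: hexagon_def faces_def S)
  ultimately show 20: "card {A. hexagon ?T A} = 20" by simp
  have v: "vertex ?T = orbit (rot ?T)" by (simp add: vertex_def fun_eq_iff)
  show "\<forall>v\<in>vertices ?T. card v = 3" using O by (auto simp: vertices_def S)
  have "3 * card (vertices ?T) = 180"
    unfolding v vertices_def card_darts_truncated_icosahedron(3)[symmetric]
    by (rule card_orbit_image) (use T O fin in \<open>auto simp: surface_map_def v S\<close>)
  moreover have "card (faces ?T) = 32"
  proof -
    have "faces ?T = {A. pentagon ?T A} \<union> {A. hexagon ?T A}"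
      using O by (auto simp: faces_def pentagon_def hexagon_def S)
    moreover have "{A. pentagon ?T A} \<inter> {A. hexagon ?T A} = {}"
      by (auto simp: pentagon_def hexagon_def)
    moreover have "finite {A. pentagon ?T A}" "finite {A. hexagon ?T A}"
      using 12 20 by (auto intro: card_ge_0_finite)
    ultimately show ?thesis using 12 20 by (simp add: card_Un_disjoint)
  qed
  moreover have "card (edges ?T) = 90"
  proof -
    have o: "opp ?T x \<in> darts ?T" "opp ?T x \<noteq> x" "opp ?T (opp ?T x) = x" if "x \<in> darts ?T" for x
      using T that by (auto simp: surface_map_def)
    have "2 * card (edges ?T) = card (\<Union> (edges ?T))"
    proof (rule card_partition)
      show un: "finite (edges ?T)" "finite (\<Union> (edges ?T))" using fin by (auto simp: edges_def)
      show "card c = 2" if "c \<in> edges ?T" for c using that o by (force simp: edges_def card_2_iff)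
      show "c1 \<inter> c2 = {}" if "c1 \<in> edges ?T" "c2 \<in> edges ?T" "c1 \<noteq> c2" for c1 c2
      proof -
        obtain x y where xy: "x \<in> darts ?T" "y \<in> darts ?T" "c1 = {x, opp ?T x}" "c2 = {y, opp ?T y}"
          using \<open>c1 \<in> edges ?T\<close> \<open>c2 \<in> edges ?T\<close> by (auto simp: edges_def)
        have "x \<noteq> y" using that(3) xy by blast
        moreover have "x \<noteq> opp ?T y" using that(3) xy(3,4) o(3)[OF xy(2)] by (metis insert_commute)
        moreover have "opp ?T x \<noteq> y" using that(3) xy(3,4) o(3)[OF xy(1)] by (metis insert_commute)
        moreover have "opp ?T x \<noteq> opp ?T y" using \<open>x \<noteq> y\<close> o(3)[OF xy(1)] o(3)[OF xy(2)] by metis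
        ultimately show ?thesis using xy(3,4) by simp
      qed
    qed
    also have "\<Union> (edges ?T) = darts ?T" using o by (auto simp: edges_def)
    finally show ?thesis using card_darts_truncated_icosahedron(3) by simp
  qed
  ultimately show "euler_char ?T = 2" by (simp add: euler_char_def)
qed

end

theory Submission
  imports Defs
begin

text \<open>
  Coverings of a pattern are coverings of its dual ribbon graph, that is, finite sets of darts
  over its set of darts on which \<open>opp\<close> and \<open>rot\<close> act compatibly and with faces of the
  same sizes.

  \<^bold>\<open>Upper bound.\<close>  In a football pattern the sizes of the faces on the two sides of a
  dart are \<open>(5, 6)\<close>, \<open>(6, 5)\<close> or \<open>(6, 6)\<close>, and the sizes for \<open>opp d\<close> and
  \<open>rot d\<close> are determined by those for \<open>d\<close>.  Hence, for two football patterns, the pairs of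
  darts with the same sizes are closed under the componentwise \<open>opp\<close> and \<open>rot\<close>.  Each
  component of this fibre product covers both patterns: its faces are no larger than those
  below, because both coordinates return to their start after 5 or 6 steps.  A fibre over
  a side of a pentagon in the first pattern consists of pairs whose second entry is a side of a
  pentagon in the second one, so the degree is at most the number of such sides; in the
  truncated icosahedron this is 12 times 5
  (\<open>common_branched_cover\<close>, \<open>card_pentagon_sides_truncated_icosahedron\<close>).

  \<^bold>\<open>Sharpness.\<close>  There is a football pattern with 30 pentagon sides and only one vertex:
  three steps of \<open>rot\<close> permute its pentagon sides in a single cycle.  In the truncated icosahedron
  three steps of \<open>rot\<close> are the identity.  In a common cover one can therefore start at any dart
  over a given pentagon side of the truncated icosahedron and, turning around its origin three
  darts at a time, change its image in the one-vertex pattern at will while the image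
  in the truncated icosahedron stays put.  So each fibre over a pentagon side of the
  one-vertex pattern meets the fibres of all 60 pentagon sides of the truncated icosahedron
  (\<open>one_vertex_pattern_degree_ge\<close>).
\<close>

section \<open>Orbits and reachability\<close>

lemma surface_mapD:
  assumes "surface_map M"
  shows "finite (darts M)" "darts M \<noteq> {}" "bij_betw (rot M) (darts M) (darts M)"
    "\<And>d. d \<in> darts M \<Longrightarrow> rot M d \<in> darts M"
    "\<And>d. d \<in> darts M \<Longrightarrow> opp M d \<in> darts M"
    "\<And>d. d \<in> darts M \<Longrightarrow> opp M d \<noteq> d"
    "\<And>d. d \<in> darts M \<Longrightarrow> opp M (opp M d) = d"
    "\<And>d e. d \<in> darts M \<Longrightarrow> e \<in> darts M \<Longrightarrow> (d, e) \<in> (dart_step M)\<^sup>*"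
  using assms bij_betwE[of "rot M" "darts M" "darts M"] by (auto simp: surface_map_def)

lemma face_next_in_darts: "surface_map M \<Longrightarrow> d \<in> darts M \<Longrightarrow> face_next M d \<in> darts M"
  by (simp add: face_next_def surface_mapD)

lemma funpow_closed: "bij_betw g S S \<Longrightarrow> x \<in> S \<Longrightarrow> (g ^^ k) x \<in> S"
  by (induction k) (auto dest: bij_betwE)

lemma self_in_orbit_bij_betw:
  assumes "finite S" "bij_betw g S S" "x \<in> S"
  shows "x \<in> orbit g x"
proof -
  have "\<not> inj_on (\<lambda>k. (g ^^ k) x) UNIV"
    using finite_subset[of "range (\<lambda>k. (g ^^ k) x)" S] assms funpow_closed[OF assms(2,3)]
    by (metis finite_imageD image_subset_iff infinite_UNIV_nat)
  then obtain i j where ij: "i < j" "(g ^^ i) x = (g ^^ j) x"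
    unfolding inj_on_def by (metis UNIV_I nat_neq_iff)
  have "inj_on (g ^^ i) S"
    using bij_betw_funpow[OF assms(2)] by (rule bij_betw_imp_inj_on)
  moreover have "(g ^^ i) x = (g ^^ i) ((g ^^ (j - i)) x)"
    using ij by (metis add_diff_inverse_nat comp_apply funpow_add less_imp_not_less)
  ultimately have "x = (g ^^ (j - i)) x"
    using assms(3) funpow_closed[OF assms(2,3)] by (auto dest: inj_onD)
  then show ?thesis
    using ij(1) by (metis (mono_tags, lifting) mem_Collect_eq orbit_altdef zero_less_diff)
qed

text \<open>
  Two permutations whose orbits have equal length thus repeat at the same times, which is how the
  faces of a fibre product are measured below.
\<close>

lemma funpow_eq_iff_mod_card_orbit:
  assumes "finite S" "bij_betw g S S" "x \<in> S"
  shows "(g ^^ i) x = (g ^^ j) x \<longleftrightarrow> i mod card (orbit g x) = j mod card (orbit g x)"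
proof -
  let ?n = "funpow_dist1 g x x"
  note self = self_in_orbit_bij_betw[OF assms]
  have inj: "inj_on (\<lambda>k. (g ^^ k) x) {0..<?n}"
    by (rule inj_on_funpow_dist1[OF self])
  have "card (orbit g x) = ?n"
    using orbit_conv_funpow_dist1[OF self] card_image[OF inj] by simp
  moreover have "(g ^^ k) x = (g ^^ (k mod ?n)) x" for k
    using funpow_dist1_prop[OF self] by (metis funpow_mod_eq)
  ultimately show ?thesis
    using inj by (metis atLeastLessThan_iff inj_onD mod_less_divisor zero_le zero_less_Suc)
qed

text \<open>
  On a finite set a permutation is inverted by one of its powers, so reachability along
  \<open>opp\<close> and \<open>rot\<close> can be traced back.
\<close>

lemma dart_step_sym:
  assumes "finite (darts M)" "bij_betw (rot M) (darts M) (darts M)"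
    "\<And>d. d \<in> darts M \<Longrightarrow> opp M d \<in> darts M \<and> opp M (opp M d) = d"
    and "(d, e) \<in> (dart_step M)\<^sup>*"
  shows "(e, d) \<in> (dart_step M)\<^sup>*"
  using assms(4)
proof induction
  case (step y z)
  then have y: "y \<in> darts M" and z: "z = opp M y \<or> z = rot M y"
    by (auto simp: dart_step_def)
  have rot_powers: "(z, (rot M ^^ k) z) \<in> (dart_step M)\<^sup>*" if "z \<in> darts M" for k z
    by (induction k) (use funpow_closed[OF assms(2) that] in \<open>auto simp: dart_step_def intro: rtrancl_into_rtrancl\<close>)
  from z have "(z, y) \<in> (dart_step M)\<^sup>*"
  proof
    assume "z = opp M y"
    then show ?thesis using y assms(3) by (auto simp: dart_step_def intro!: r_into_rtrancl)
  next
    assume z: "z = rot M y"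
    obtain k where "y = (rot M ^^ k) y" "k > 0"
      using self_in_orbit_bij_betw[OF assms(1,2) y] by (auto simp: orbit_altdef)
    then have "y = (rot M ^^ (k - 1)) z"
      using z by (metis Suc_diff_1 comp_apply funpow_Suc_right)
    moreover have "z \<in> darts M" using z y assms(2) by (auto dest: bij_betwE)
    ultimately show ?thesis using rot_powers by metis
  qed
  then show ?case using step.IH by (rule rtrancl_trans)
qed simp

lemma dart_step_rtrancl_closed:
  assumes "\<And>d. d \<in> S \<Longrightarrow> opp M d \<in> S \<and> rot M d \<in> S" "(d, e) \<in> (dart_step M)\<^sup>*" "d \<in> S"
  shows "e \<in> S"
  using assms(2,3,1) by induction (auto simp: dart_step_def)

text \<open>
  A fibre product of connected ribbon graphs need not be connected.  Its components can be taken as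
  the sets of darts reachable from one dart, since reachability is symmetric.
\<close>

definition component :: "'a ribbon_graph \<Rightarrow> 'a \<Rightarrow> 'a ribbon_graph" where
  "component M d = M\<lparr>darts := (dart_step M)\<^sup>* `` {d}\<rparr>"

lemma surface_map_component:
  assumes fin: "finite (darts M)" and bij: "bij_betw (rot M) (darts M) (darts M)"
    and opp: "\<And>d. d \<in> darts M \<Longrightarrow> opp M d \<in> darts M \<and> opp M d \<noteq> d \<and> opp M (opp M d) = d"
    and d: "d \<in> darts M"
  shows "surface_map (component M d)" "darts (component M d) \<subseteq> darts M"
proof -
  let ?C = "(dart_step M)\<^sup>* `` {d}"
  have rot: "rot M x \<in> darts M" if "x \<in> darts M" for x using that bij by (auto dest: bij_betwE)
  show sub: "darts (component M d) \<subseteq> darts M"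
    using dart_step_rtrancl_closed[of "darts M" M d] opp rot d by (auto simp: component_def)
  have C: "?C \<subseteq> darts M" using sub by (simp add: component_def)
  have step: "opp M x \<in> ?C" "rot M x \<in> ?C" if "x \<in> ?C" for x
  proof -
    have "(x, opp M x) \<in> dart_step M" "(x, rot M x) \<in> dart_step M"
      using that C by (auto simp: dart_step_def)
    then show "opp M x \<in> ?C" "rot M x \<in> ?C" using that by (auto intro: rtrancl_into_rtrancl)
  qed
  have finC: "finite ?C" using C fin by (rule finite_subset)
  have inj: "inj_on (rot M) ?C" using bij C by (auto simp: bij_betw_def intro: inj_on_subset)
  then have bijC: "bij_betw (rot M) ?C ?C"
    using finC step(2) by (simp add: bij_betw_def endo_inj_surj image_subset_iff)
  have steps: "dart_step (component M d) = dart_step M \<inter> (?C \<times> UNIV)"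
    using C by (auto simp: dart_step_def component_def)
  have conn: "(x, y) \<in> (dart_step (component M d))\<^sup>*" if "x \<in> ?C" "y \<in> ?C" for x y
  proof -
    have "(x, d) \<in> (dart_step M)\<^sup>*"
      by (rule dart_step_sym[OF fin bij]) (use opp that(1) in auto)
    then have "(x, y) \<in> (dart_step M)\<^sup>*" using that(2) by (auto intro: rtrancl_trans)
    then show ?thesis
    proof induction
      case (step y z)
      then have "y \<in> ?C" using that(1) by (auto intro: rtrancl_trans)
      then show ?case using step steps by (auto intro: rtrancl_into_rtrancl)
    qed simp
  qed
  have "d \<in> ?C" by simp
  then show "surface_map (component M d)"
    using conn finC bijC opp C step unfolding surface_map_def by (auto simp: component_def)
qed

section \<open>Coverings\<close>

lemma covering_dualD:
  assumes "ribbon_covering f (dual H) (dual G)" "surface_map H" "surface_map G"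
  shows "f ` darts H = darts G"
    "\<And>d. d \<in> darts H \<Longrightarrow> f d \<in> darts G"
    "\<And>d. d \<in> darts H \<Longrightarrow> f (opp H d) = opp G (f d)"
    "\<And>d. d \<in> darts H \<Longrightarrow> f (rot H d) = rot G (f d)"
    "\<And>d. d \<in> darts H \<Longrightarrow> f (face_next H d) = face_next G (f d)"
    "\<And>d. d \<in> darts H \<Longrightarrow> card (face H d) = card (face G (f d))"
  using assms(1) ribbon_covering_dual_iff[OF assms(2,3)] surface_mapD(4,5)[OF assms(2)]
  by (auto simp: face_next_def)

text \<open>
  Since \<open>opp\<close> and \<open>rot\<close> are injective upstairs, fibres do not shrink along a step downstairs;
  by connectedness they cannot grow either.
\<close>

lemma covering_has_degree:
  assumes cov: "ribbon_covering f (dual H) (dual G)" and H: "surface_map H" and G: "surface_map G"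
  obtains D where "has_degree f (dual H) (dual G) D"
proof -
  let ?F = "\<lambda>d. {e \<in> darts H. f e = d}"
  note c = covering_dualD[OF cov H G] and h = surface_mapD[OF H] and g = surface_mapD[OF G]
  have mono_step: "card (?F d) \<le> card (?F e)" if "(d, e) \<in> dart_step G" for d e
  proof -
    obtain s where s: "s = opp H \<or> s = rot H" "\<And>x. x \<in> ?F d \<Longrightarrow> s x \<in> ?F e"
    proof (cases "e = opp G d")
      case True
      show thesis by (rule that[of "opp H"]) (use True c(3) h(5) in auto)
    next
      case False
      then have "e = rot G d" using \<open>(d, e) \<in> dart_step G\<close> by (auto simp: dart_step_def)
      then show thesis by (intro that[of "rot H"]) (use c(4) h(4) in auto)
    qed
    have "inj_on (opp H) (darts H)" using h(7) by (rule inj_on_inverseI)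
    moreover have "inj_on (rot H) (darts H)" using h(3) by (rule bij_betw_imp_inj_on)
    ultimately have "inj_on s (?F d)" using s(1) by (auto intro: inj_on_subset)
    then show ?thesis using s(2) h(1) by (intro card_inj_on_le) auto
  qed
  have mono: "card (?F d) \<le> card (?F e)" if "(d, e) \<in> (dart_step G)\<^sup>*" for d e
    using that by induction (auto intro: order_trans mono_step)
  obtain d0 where "d0 \<in> darts G" using g(2) by blast
  then have "has_degree f (dual H) (dual G) (card (?F d0))"
    unfolding has_degree_def dual_def using mono g(8) by (auto intro!: antisym)
  then show thesis by (rule that)
qed

lemma ribbon_covering_comp:
  assumes "ribbon_covering f H G" "ribbon_covering g K H"
  shows "ribbon_covering (\<lambda>x. f (g x)) K G"
proof -
  have "g d \<in> darts H" if "d \<in> darts K" for d using assms(2) that by (auto simp: ribbon_covering_def)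
  moreover have "(\<lambda>x. f (g x)) ` darts K = darts G"
    using assms by (metis ribbon_covering_def image_image)
  ultimately show ?thesis
    using assms by (simp add: ribbon_covering_def) (blast intro: bij_betw_trans[unfolded comp_def])
qed

lemma pentagon_face_iff: "d \<in> darts M \<Longrightarrow> pentagon M (face M d) \<longleftrightarrow> card (face M d) = 5"
  and hexagon_face_iff: "d \<in> darts M \<Longrightarrow> hexagon M (face M d) \<longleftrightarrow> card (face M d) = 6"
  by (auto simp: pentagon_def hexagon_def faces_def)

text \<open>
  Written with the numbers of sides of the faces next to a dart, each condition of a football
  pattern becomes a condition on single darts, so that it can be compared along coverings.
\<close>

lemma football_pattern_iff:
  assumes M: "surface_map M"
  shows "football_pattern M \<longleftrightarrow>
    (\<forall>d\<in>darts M. card (vertex M d) \<ge> 3 \<and>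
      (card (face M d) = 5 \<and> card (face M (opp M d)) = 6 \<or>
       card (face M d) = 6 \<and>
        (card (face M (opp M d)) = 5 \<and> card (face M (opp M (face_next M d))) = 6 \<or>
         card (face M (opp M d)) = 6 \<and> card (face M (opp M (face_next M d))) = 5)))"
    (is "_ \<longleftrightarrow> ?R")
proof -
  note D = surface_mapD(5)[OF M] face_next_in_darts[OF M]
  have "football_pattern M \<longleftrightarrow>
    (\<forall>d\<in>darts M. card (vertex M d) \<ge> 3) \<and>
    (\<forall>d\<in>darts M. card (face M d) = 5 \<or> card (face M d) = 6) \<and>
    (\<forall>d\<in>darts M. card (face M d) = 5 \<longrightarrow> card (face M (opp M d)) = 6) \<and>
    (\<forall>d\<in>darts M. card (face M d) = 6 \<longrightarrow>
      (card (face M (opp M d)) = 5 \<longleftrightarrow> card (face M (opp M (face_next M d))) = 6))"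
    unfolding football_pattern_def vertices_def faces_def
    using M by (auto simp: pentagon_face_iff hexagon_face_iff D)
  also have "\<dots> \<longleftrightarrow> ?R"
    using D by (auto; smt (verit) D numeral_eq_iff semiring_norm)
  finally show ?thesis .
qed

text \<open>
  All conditions on a football pattern, apart from the valencies of the vertices, speak about the
  numbers of sides of neighbouring faces, which a covering preserves; and a vertex of the
  cover wraps around its image, so that its valency is at least as large.
\<close>

lemma football_pattern_covering:
  assumes cov: "ribbon_covering f (dual H) (dual G)" and H: "surface_map H" and G: "football_pattern G"
  shows "football_pattern H"
proof -
  have G': "surface_map G" using G by (simp add: football_pattern_def)
  note c = covering_dualD[OF cov H G'] and h = surface_mapD[OF H]
  have "card (vertex G (f d)) \<le> card (vertex H d)" if "d \<in> darts H" for d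
  proof -
    have "f ` vertex H d = vertex G (f d)"
      unfolding vertex_def by (rule orbit_image_commute[OF h(3)]) (use c(4) that in auto)
    moreover have "finite (vertex H d)"
      unfolding vertex_def using orbit_subset_closed[OF h(3) that] h(1) by (rule finite_subset)
    ultimately show ?thesis by (metis card_image_le)
  qed
  then show ?thesis
    using G unfolding football_pattern_iff[OF H] football_pattern_iff[OF G']
    using c(2,3,5,6) h(5) face_next_in_darts[OF H] by (auto 0 0; smt (verit) order_trans)
qed

text \<open>
  A map compatible with \<open>opp\<close> and \<open>rot\<close> hits, with every dart, all darts
  reachable from it; hence it is onto as soon as the target is connected.
\<close>

lemma ribbon_covering_dualI:
  assumes H: "surface_map H" and G: "surface_map G"
    and f: "\<And>d. d \<in> darts H \<Longrightarrow> f d \<in> darts G \<and> f (opp H d) = opp G (f d) \<and>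
      f (rot H d) = rot G (f d) \<and> card (face H d) = card (face G (f d))"
  shows "ribbon_covering f (dual H) (dual G)"
proof -
  note h = surface_mapD[OF H]
  obtain d where d: "d \<in> darts H" using h(2) by blast
  have "e \<in> f ` darts H" if "e \<in> darts G" for e
  proof (rule dart_step_rtrancl_closed)
    show "(f d, e) \<in> (dart_step G)\<^sup>*" using d f that surface_mapD(8)[OF G] by blast
    show "f d \<in> f ` darts H" using d by blast
    show "opp G x \<in> f ` darts H \<and> rot G x \<in> f ` darts H" if "x \<in> f ` darts H" for x
      using that f h(4,5) by (metis (no_types, lifting) image_iff)
  qed
  then have "f ` darts H = darts G" using f by blast
  then show ?thesis using f by (simp add: ribbon_covering_dual_iff[OF H G])
qed

text \<open>
  If \<open>M\<close> covers a pattern, so does the copy, by composition; as the covering from the copy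
  to \<open>M\<close> is injective, the fibres keep their sizes.
\<close>

lemma surface_map_nat_copy:
  assumes M: "surface_map M"
  obtains N :: "nat ribbon_graph" and f
  where "surface_map N" "inj_on f (darts N)" "ribbon_covering f (dual N) (dual M)"
proof -
  note m = surface_mapD[OF M]
  obtain h :: "'a \<Rightarrow> nat" where inj: "inj_on h (darts M)"
    using finite_imp_inj_to_nat_seg[OF m(1)] by blast
  define f where "f = inv_into (darts M) h"
  define N where "N = \<lparr>darts = h ` darts M, opp = \<lambda>x. h (opp M (f x)), rot = \<lambda>x. h (rot M (f x))\<rparr>"
  have fh: "f (h d) = d" if "d \<in> darts M" for d using inj that by (simp add: f_def)
  have fN: "inj_on f (darts N)" "\<And>d. d \<in> darts N \<Longrightarrow> f d \<in> darts M"
    using fh by (auto simp: N_def inj_on_def)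
  have bij: "bij_betw (rot N) (darts N) (darts N)"
    unfolding bij_betw_def
  proof (intro conjI)
    show "inj_on (rot N) (darts N)"
      using fh m(4) inj_on_eq_iff[OF inj] inj_on_eq_iff[OF bij_betw_imp_inj_on[OF m(3)]]
      by (auto simp: N_def inj_on_def)
    have "rot N ` darts N = h ` rot M ` darts M" using fh by (force simp: N_def)
    then show "rot N ` darts N = darts N" using m(3) by (simp add: bij_betw_def N_def)
  qed
  have conn: "(h d, h e) \<in> (dart_step N)\<^sup>*" if "(d, e) \<in> (dart_step M)\<^sup>*" for d e
    using that
  proof induction
    case (step y z)
    then have "(h y, h z) \<in> dart_step N" using fh by (auto simp: dart_step_def N_def)
    with step.IH show ?case by (rule rtrancl_into_rtrancl)
  qed simp
  have "opp N x \<in> darts N \<and> opp N x \<noteq> x \<and> opp N (opp N x) = x" if "x \<in> darts N" for x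
    using that fh m(5,6,7) by (auto simp: N_def) (metis fh)
  then have N: "surface_map N"
    using bij conn m(1,2,8) unfolding surface_map_def by (auto simp: N_def)
  have com: "f (opp N d) = opp M (f d)" "f (rot N d) = rot M (f d)" if "d \<in> darts N" for d
    using that fh m(4,5) by (auto simp: N_def)
  have "card (face N d) = card (face M (f d))" if d: "d \<in> darts N" for d
  proof -
    have "f ` face N d = face M (f d)"
      unfolding face_def
      by (rule orbit_image_commute[OF bij_face_next[OF N]])
        (use com surface_mapD(5)[OF N] d in \<open>auto simp: face_next_def\<close>)
    moreover have "inj_on f (face N d)"
      unfolding face_def using fN(1) orbit_subset_closed[OF bij_face_next[OF N] d] by (rule inj_on_subset)
    ultimately show ?thesis by (metis card_image)
  qed
  then have "ribbon_covering f (dual N) (dual M)"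
    using fN(2) com by (intro ribbon_covering_dualI[OF N M]) simp
  then show thesis using that N fN(1) by blast
qed

section \<open>The fibre product of two football patterns\<close>

definition side_type :: "'a ribbon_graph \<Rightarrow> 'a \<Rightarrow> nat \<times> nat" where
  "side_type M d = (card (face M d), card (face M (opp M d)))"

text \<open>
  Restricting to pairs of darts of the same type makes the two faces and the two opposite faces
  agree in size, so that both projections can preserve the sizes of faces.
\<close>

definition fibre_product :: "'a ribbon_graph \<Rightarrow> 'b ribbon_graph \<Rightarrow> ('a \<times> 'b) ribbon_graph" where
  "fibre_product P Q =
    \<lparr>darts = {(x, y). x \<in> darts P \<and> y \<in> darts Q \<and> side_type P x = side_type Q y},
     opp = map_prod (opp P) (opp Q), rot = map_prod (rot P) (rot Q)\<rparr>"

lemma side_type_opp: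
  "surface_map M \<Longrightarrow> d \<in> darts M \<Longrightarrow> side_type M (opp M d) = prod.swap (side_type M d)"
  by (simp add: side_type_def surface_mapD)

lemma face_face_next:
  assumes "surface_map M" "d \<in> darts M"
  shows "face M (face_next M d) = face M d"
  unfolding face_def
  by (rule self_in_orbit_step[OF self_in_orbit_bij_betw[OF surface_mapD(1)[OF assms(1)] bij_face_next[OF assms(1)] assms(2)]])

lemma side_type_face_next:
  assumes "football_pattern M" "d \<in> darts M"
  shows "side_type M (face_next M d) =
    (if side_type M d = (6, 5) then (6, 6) else if side_type M d = (6, 6) then (6, 5) else (5, 6))"
    and "side_type M d \<in> {(5, 6), (6, 5), (6, 6)}"
proof -
  have M: "surface_map M" using assms(1) by (simp add: football_pattern_def)
  note D = assms(1)[unfolded football_pattern_iff[OF M], rule_format]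
  show "side_type M d \<in> {(5, 6), (6, 5), (6, 6)}"
    using D[OF assms(2)] by (auto simp: side_type_def)
  show "side_type M (face_next M d) =
    (if side_type M d = (6, 5) then (6, 6) else if side_type M d = (6, 6) then (6, 5) else (5, 6))"
    using D[OF assms(2)] D[OF face_next_in_darts[OF M assms(2)]]
    by (auto simp: side_type_def face_face_next[OF M assms(2)])
qed

text \<open>
  The type of a dart determines the type of the next one around its origin: this is what makes the
  fibre product closed under \<open>rot\<close>.  Around a vertex the types recur with period three.
\<close>

lemma side_type_rot:
  assumes "football_pattern M" "d \<in> darts M"
  shows "side_type M (rot M d) =
    (if side_type M d = (5, 6) then (6, 6) else if side_type M d = (6, 6) then (6, 5) else (5, 6))"
proof -
  have M: "surface_map M" using assms(1) by (simp add: football_pattern_def)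
  have "rot M d = face_next M (opp M d)"
    using assms by (simp add: face_next_def surface_mapD[OF M])
  then show ?thesis
    using side_type_face_next(1)[OF assms(1) surface_mapD(5)[OF M assms(2)]]
      side_type_opp[OF M assms(2)] side_type_face_next(2)[OF assms] by auto
qed

lemma ex_pentagon_side:
  assumes "football_pattern M"
  obtains d where "d \<in> darts M" "side_type M d = (5, 6)"
proof -
  have M: "surface_map M" using assms by (simp add: football_pattern_def)
  obtain d where d: "d \<in> darts M" using surface_mapD(2)[OF M] by blast
  note rot = surface_mapD(4)[OF M]
  show thesis
    using side_type_face_next(2)[OF assms d] side_type_rot[OF assms d]
      side_type_rot[OF assms rot[OF d]] that d rot[OF d] rot[OF rot[OF d]] by auto
qed

text \<open>
  The orbit of a pair has as its length the least common multiple of the lengths of the orbits of its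
  entries.  When these are equal, the first projection is already injective on it.
\<close>

lemma card_orbit_map_prod:
  assumes A: "finite A" "bij_betw g A A" "x \<in> A" and B: "finite B" "bij_betw h B B" "y \<in> B"
    and eq: "card (orbit g x) = card (orbit h y)"
  shows "card (orbit (map_prod g h) (x, y)) = card (orbit g x)"
proof -
  let ?O = "orbit (map_prod g h) (x, y)"
  have pow: "(map_prod g h ^^ k) (x, y) = ((g ^^ k) x, (h ^^ k) y)" for k
    by (induction k) auto
  have "fst ` ?O = orbit g x"
    by (subst orbit_image_commute[where S = "A \<times> B" and h = g])
      (use A B in \<open>auto simp: map_prod_def intro!: bij_betw_map_prod[unfolded map_prod_def]\<close>)
  moreover have "inj_on fst ?O"
  proof (rule inj_onI)
    fix u v assume "u \<in> ?O" "v \<in> ?O" and fst: "fst u = fst v"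
    then obtain i j where "u = (map_prod g h ^^ i) (x, y)" "v = (map_prod g h ^^ j) (x, y)"
      by (auto simp: orbit_altdef)
    then show "u = v"
      using fst eq by (simp add: pow funpow_eq_iff_mod_card_orbit[OF A] funpow_eq_iff_mod_card_orbit[OF B])
  qed
  ultimately show ?thesis by (metis card_image)
qed

lemma fibre_product_component:
  assumes P: "football_pattern P" and Q: "football_pattern Q"
    and x: "x \<in> darts P" and y: "y \<in> darts Q" and type: "side_type P x = side_type Q y"
  defines "C \<equiv> component (fibre_product P Q) (x, y)"
  shows "surface_map C" "darts C \<subseteq> darts (fibre_product P Q)"
    "ribbon_covering fst (dual C) (dual P)" "ribbon_covering snd (dual C) (dual Q)"
proof -
  let ?F = "fibre_product P Q"
  have P': "surface_map P" and Q': "surface_map Q"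
    using P Q by (simp_all add: football_pattern_def)
  note p = surface_mapD[OF P'] and q = surface_mapD[OF Q']
  have sub: "darts ?F \<subseteq> darts P \<times> darts Q" by (auto simp: fibre_product_def)
  then have fin: "finite (darts ?F)" using p(1) q(1) by (meson finite_SigmaI finite_subset)
  have rot: "rot ?F ` darts ?F \<subseteq> darts ?F"
    using p(4) q(4) side_type_rot[OF P] side_type_rot[OF Q] by (auto simp: fibre_product_def)
  have "inj_on (rot ?F) (darts P \<times> darts Q)"
    using bij_betw_imp_inj_on[OF p(3)] bij_betw_imp_inj_on[OF q(3)]
    by (simp add: fibre_product_def map_prod_inj_on)
  then have "inj_on (rot ?F) (darts ?F)" using sub by (rule inj_on_subset)
  then have bij: "bij_betw (rot ?F) (darts ?F) (darts ?F)"
    using rot fin by (simp add: bij_betw_def endo_inj_surj)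
  have opp: "opp ?F d \<in> darts ?F \<and> opp ?F d \<noteq> d \<and> opp ?F (opp ?F d) = d" if "d \<in> darts ?F" for d
    using that p(5,6,7) q(5,6,7) side_type_opp[OF P'] side_type_opp[OF Q']
    by (auto simp: fibre_product_def)
  have xy: "(x, y) \<in> darts ?F" using x y type by (simp add: fibre_product_def)
  show C: "surface_map C" and CF: "darts C \<subseteq> darts ?F"
    unfolding C_def by (rule surface_map_component[OF fin bij opp xy]; assumption)+
  have ops: "opp C = map_prod (opp P) (opp Q)" "rot C = map_prod (rot P) (rot Q)"
    by (simp_all add: C_def component_def fibre_product_def)
  then have fn: "face_next C = map_prod (face_next P) (face_next Q)"
    by (auto simp: face_next_def fun_eq_iff)
  have D: "a \<in> darts P" "b \<in> darts Q" "card (face P a) = card (face Q b)" if "(a, b) \<in> darts C" for a b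
    using that CF by (auto simp: fibre_product_def side_type_def)
  have face: "card (face C (a, b)) = card (face P a)" if "(a, b) \<in> darts C" for a b
    using card_orbit_map_prod[OF p(1) bij_face_next[OF P'] D(1)[OF that] q(1) bij_face_next[OF Q'] D(2)[OF that]]
      D(3)[OF that] by (simp add: face_def fn)
  show "ribbon_covering fst (dual C) (dual P)"
    using D face by (intro ribbon_covering_dualI[OF C P']) (auto simp: ops)
  show "ribbon_covering snd (dual C) (dual Q)"
    using D face by (intro ribbon_covering_dualI[OF C Q']) (auto simp: ops)
qed

text \<open>
  Starting the component at a pair of pentagon sides makes the fibre over the first of them
  consist of pentagon sides of \<open>Q\<close>.
\<close>

lemma common_branched_cover:
  assumes P: "football_pattern P" and Q: "football_pattern Q"
  obtains R :: "nat ribbon_graph" and D D'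
  where "D \<le> card {y \<in> darts Q. card (face Q y) = 5}"
    "branched_cover D R P" "branched_cover D' R Q"
proof -
  have P': "surface_map P" and Q': "surface_map Q"
    using P Q by (simp_all add: football_pattern_def)
  obtain x where x: "x \<in> darts P" "side_type P x = (5, 6)" using ex_pentagon_side[OF P] by blast
  obtain y where y: "y \<in> darts Q" "side_type Q y = (5, 6)" using ex_pentagon_side[OF Q] by blast
  define C where "C = component (fibre_product P Q) (x, y)"
  have xy: "side_type P x = side_type Q y" using x y by simp
  note C = fibre_product_component[OF P Q x(1) y(1) xy, folded C_def]
  obtain R :: "nat ribbon_graph" and f
    where R: "surface_map R" "inj_on f (darts R)" "ribbon_covering f (dual R) (dual C)"
    using surface_map_nat_copy[OF C(1)] by blast
  note p = ribbon_covering_comp[OF C(3) R(3)] and q = ribbon_covering_comp[OF C(4) R(3)]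
  have foot: "football_pattern R" using football_pattern_covering[OF p R(1) P] .
  obtain D where D: "has_degree (\<lambda>z. fst (f z)) (dual R) (dual P) D"
    using covering_has_degree[OF p R(1) P'] by blast
  obtain D' where D': "has_degree (\<lambda>z. snd (f z)) (dual R) (dual Q) D'"
    using covering_has_degree[OF q R(1) Q'] by blast
  have "D = card {z \<in> darts R. fst (f z) = x}"
    using D x(1) by (simp add: has_degree_def dual_def)
  also have "\<dots> \<le> card {y \<in> darts Q. card (face Q y) = 5}"
  proof (rule card_inj_on_le)
    show "inj_on (\<lambda>z. snd (f z)) {z \<in> darts R. fst (f z) = x}"
      using R(2) by (auto simp: inj_on_def prod_eq_iff)
    have "f z \<in> darts (fibre_product P Q)" if "z \<in> darts R" for z
      using that covering_dualD(2)[OF R(3,1) C(1)] C(2) by blast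
    then show "(\<lambda>z. snd (f z)) ` {z \<in> darts R. fst (f z) = x} \<subseteq> {y \<in> darts Q. card (face Q y) = 5}"
      using x(2) by (fastforce simp: fibre_product_def side_type_def)
    show "finite {y \<in> darts Q. card (face Q y) = 5}" using surface_mapD(1)[OF Q'] by simp
  qed
  finally show thesis
    using that foot P Q p q D D' unfolding branched_cover_def by blast
qed

lemma card_pentagon_sides_truncated_icosahedron:
  "card {y \<in> darts truncated_icosahedron. card (face truncated_icosahedron y) = 5} = 60"
proof -
  have "{y \<in> darts truncated_icosahedron. card (face truncated_icosahedron y) = 5} = Pred ` darts icosahedron"
    using truncated_icosahedron_orbits truncation_simps(1)[of icosahedron, folded truncated_icosahedron_def] by auto
  then show ?thesis using card_darts_truncated_icosahedron(2) by simp
qed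

section \<open>A football pattern with a single vertex\<close>

text \<open>
  The sides of pentagons are the multiples \<open>3 * b\<close> with \<open>b\<close> modulo 30; the darts opposite to
  them are those congruent to 2 modulo 3, and the darts between two hexagons those congruent to 1.
  On the numbers \<open>b\<close>, going to the next side of the pentagon adds 6, going to the next
  pentagon side around the adjacent hexagon adds 10, and following the edge between two hexagons
  adds 15.  These have orders 5, 3 and 2, as needed for pentagons, hexagons and edges, and
  turning around the origin by three darts combines them into \<open>6 + 10 + 15 = 31\<close>, which is 1
  modulo 30, so that there is just one vertex.  Numbering all darts consecutively around
  this vertex gives the formulas below, where \<open>17 + 73 = 90\<close> and \<open>45 + 45 = 90\<close>.
\<close>

definition one_vertex_pattern :: "nat ribbon_graph" where
  "one_vertex_pattern =
    \<lparr>darts = {..<90},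
     opp = (\<lambda>d. (d + (if d mod 3 = 0 then 17 else if d mod 3 = 1 then 45 else 73)) mod 90),
     rot = (\<lambda>d. (d + 1) mod 90)\<rparr>"

lemma rot_power_one_vertex_pattern:
  "d < 90 \<Longrightarrow> (rot one_vertex_pattern ^^ k) d = (d + k) mod 90"
  by (induction k) (simp_all add: one_vertex_pattern_def mod_Suc_eq)

lemma add_mod_left_cancel:
  fixes d k j m :: nat
  assumes "k < m" "j < m"
  shows "(d + k) mod m = (d + j) mod m \<longleftrightarrow> k = j"
proof -
  have "k = j" if "(d + k) mod m = (d + j) mod m" "k \<le> j" "j < m" for k j
  proof -
    have "m dvd (d + j) - (d + k)" using that by (metis mod_eq_dvd_iff_nat add_le_cancel_left)
    then show ?thesis using that by (auto dest: dvd_imp_le)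
  qed
  then show ?thesis using assms by (metis nat_le_linear)
qed

text \<open>
  The argument is reduced modulo 90 here so that repeated steps can be evaluated as additions of
  constants, each constant being found from the residue modulo 3.
\<close>

lemma opp_one_vertex_pattern:
  "opp one_vertex_pattern (d mod 90) = (d + (if d mod 3 = 0 then 17 else if d mod 3 = 1 then 45 else 73)) mod 90"
  by (simp add: one_vertex_pattern_def mod_mod_cancel mod_add_left_eq)

lemma face_next_one_vertex_pattern:
  "face_next one_vertex_pattern (d mod 90) = (d + (if d mod 3 = 0 then 18 else if d mod 3 = 1 then 46 else 74)) mod 90"
  by (simp add: face_next_def opp_one_vertex_pattern) (simp add: one_vertex_pattern_def mod_Suc_eq add.commute)

lemma mod_3_cases: obtains "d mod 3 = 0" | "d mod 3 = 1" | "d mod 3 = (2::nat)" by linarith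

lemma opp_involution_one_vertex_pattern:
  assumes "d < 90" shows "opp one_vertex_pattern d \<noteq> d"
    "opp one_vertex_pattern (opp one_vertex_pattern d) = d"
proof -
  note opp = opp_one_vertex_pattern[of d] opp_one_vertex_pattern[of "d + _"]
  have m: "(d + k) mod 3 = (d mod 3 + k) mod 3" for k by (simp add: mod_add_left_eq)
  have d: "d mod 90 = d" using assms by simp
  show "opp one_vertex_pattern d \<noteq> d"
    using opp(1) assms add_mod_left_cancel[of _ 90 0 d] by (simp split: if_splits)
  show "opp one_vertex_pattern (opp one_vertex_pattern d) = d"
    by (rule mod_3_cases[of d]) (use assms in \<open>simp_all add: opp[unfolded d] opp m add.assoc\<close>)
qed

lemma surface_map_one_vertex_pattern: "surface_map one_vertex_pattern"
proof -
  let ?Z = one_vertex_pattern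
  have opp: "opp ?Z d \<in> darts ?Z \<and> opp ?Z d \<noteq> d \<and> opp ?Z (opp ?Z d) = d" if "d \<in> darts ?Z" for d
  proof -
    have "d < 90" using that by (simp add: one_vertex_pattern_def)
    moreover have "opp ?Z d \<in> darts ?Z" by (simp add: one_vertex_pattern_def)
    ultimately show ?thesis using opp_involution_one_vertex_pattern by blast
  qed
  have bij: "bij_betw (rot ?Z) (darts ?Z) (darts ?Z)"
    by (rule bij_betwI[where g = "\<lambda>d. (d + 89) mod 90"]) (auto simp: one_vertex_pattern_def mod_simps)
  have steps: "(d, (rot ?Z ^^ k) d) \<in> (dart_step ?Z)\<^sup>*" if "d \<in> darts ?Z" for d k
    by (induction k) (use funpow_closed[OF bij that] in \<open>auto simp: dart_step_def intro: rtrancl_into_rtrancl\<close>)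
  have "(d, e) \<in> (dart_step ?Z)\<^sup>*" if "d \<in> darts ?Z" "e \<in> darts ?Z" for d e
    using steps[OF that(1), of "e + 90 - d"] that rot_power_one_vertex_pattern[of d "e + 90 - d"]
    by (simp add: one_vertex_pattern_def)
  moreover have "finite (darts ?Z)" "0 \<in> darts ?Z" by (simp_all add: one_vertex_pattern_def)
  ultimately show ?thesis using opp bij unfolding surface_map_def by blast
qed

text \<open>
  Multiples of 3 advance by 18 around a pentagon.  Around a hexagon the other darts advance by 46
  and 74 alternately, that is by 30 in two steps.
\<close>

lemma card_face_one_vertex_pattern:
  assumes "d < 90"
  shows "card (face one_vertex_pattern d) = (if d mod 3 = 0 then 5 else 6)"
proof -
  note n = face_next_one_vertex_pattern[of d] face_next_one_vertex_pattern[of "d + _"]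
  have m: "(d + k) mod 3 = (d mod 3 + k) mod 3" for k by (simp add: mod_add_left_eq)
  have d: "d mod 90 = d" using assms by simp
  have c: "(d + k) mod 90 = (d + j) mod 90 \<longleftrightarrow> k mod 90 = j mod 90" for k j
    using add_mod_left_cancel[of "k mod 90" 90 "j mod 90" d] by (simp add: mod_add_right_eq)
  have c0: "(d + k) mod 90 = d \<longleftrightarrow> k mod 90 = 0"  "d = (d + k) mod 90 \<longleftrightarrow> k mod 90 = 0" for k
    using c[of k 0] d by auto
  show ?thesis
  proof (rule mod_3_cases[of d])
    assume "d mod 3 = 0"
    then show ?thesis unfolding face_def
      by (subst card_orbit_5) (simp_all add: n[unfolded d] n m c c0 add.assoc assms)
  next
    assume "d mod 3 = 1"
    then show ?thesis unfolding face_def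
      by (subst card_orbit_6) (simp_all add: n[unfolded d] n m c c0 add.assoc assms)
  next
    assume "d mod 3 = 2"
    then show ?thesis unfolding face_def
      by (subst card_orbit_6) (simp_all add: n[unfolded d] n m c c0 add.assoc assms)
  qed
qed
lemma football_pattern_one_vertex_pattern: "football_pattern one_vertex_pattern"
proof -
  let ?Z = one_vertex_pattern
  note Z = surface_map_one_vertex_pattern
  have V: "card (vertex ?Z d) \<ge> 3" if d: "d < 90" for d
  proof -
    have "card (vertex ?Z d) = 90"
      unfolding vertex_def
    proof (rule card_orbit_iter)
      show "distinct (map (\<lambda>k. (rot ?Z ^^ k) d) [0..<90])"
        using d by (auto simp: distinct_map rot_power_one_vertex_pattern inj_on_def add_mod_left_cancel)
    qed (use d in \<open>simp_all add: rot_power_one_vertex_pattern\<close>)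
    then show ?thesis by simp
  qed
  have F: "card (face ?Z d) = (if d mod 3 = 0 then 5 else 6)" if "d \<in> darts ?Z" for d
    using that card_face_one_vertex_pattern by (simp add: one_vertex_pattern_def)
  have m: "(d + k) mod 90 mod 3 = (d mod 3 + k) mod 3" for d k :: nat
    by (simp add: mod_mod_cancel mod_add_left_eq)
  have types: "opp ?Z d mod 3 = (if d mod 3 = 0 then 2 else if d mod 3 = 1 then 1 else 0)"
    "face_next ?Z d mod 3 = (if d mod 3 = 0 then 0 else if d mod 3 = 1 then 2 else 1)"
    if "d \<in> darts ?Z" for d
  proof -
    have d: "d mod 90 = d" using that by (simp add: one_vertex_pattern_def)
    note n = opp_one_vertex_pattern[of d] face_next_one_vertex_pattern[of d]
    show "opp ?Z d mod 3 = (if d mod 3 = 0 then 2 else if d mod 3 = 1 then 1 else 0)"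
      "face_next ?Z d mod 3 = (if d mod 3 = 0 then 0 else if d mod 3 = 1 then 2 else 1)"
      by (rule mod_3_cases[of d]; simp add: n[unfolded d] m)+
  qed
  show ?thesis
    unfolding football_pattern_iff[OF Z]
  proof
    fix d assume d: "d \<in> darts ?Z"
    note o = surface_mapD(5)[OF Z d] and n = face_next_in_darts[OF Z d]
    note on = surface_mapD(5)[OF Z n]
    have "card (vertex ?Z d) \<ge> 3" using V d by (simp add: one_vertex_pattern_def)
    then show "card (vertex ?Z d) \<ge> 3 \<and>
      (card (face ?Z d) = 5 \<and> card (face ?Z (opp ?Z d)) = 6 \<or>
       card (face ?Z d) = 6 \<and>
        (card (face ?Z (opp ?Z d)) = 5 \<and> card (face ?Z (opp ?Z (face_next ?Z d))) = 6 \<or>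
         card (face ?Z (opp ?Z d)) = 6 \<and> card (face ?Z (opp ?Z (face_next ?Z d))) = 5))"
      unfolding F[OF d] F[OF o] F[OF on] types(1)[OF d] types(1)[OF n] types(2)[OF d]
      by - (rule mod_3_cases[of d]; simp)
  qed
qed

text \<open>
  The fibre over the dart 0 is shown to map onto all pentagon sides of the truncated icosahedron: a
  dart over any one of these is turned by multiples of three darts until it lies over 0.
\<close>

lemma one_vertex_pattern_degree_ge:
  assumes "branched_cover D R one_vertex_pattern" "branched_cover D' R truncated_icosahedron"
  shows "D \<ge> 60"
proof -
  let ?Z = one_vertex_pattern and ?T = truncated_icosahedron
  have R: "surface_map R" and T: "surface_map ?T"
    using assms(2) by (simp_all add: branched_cover_def football_pattern_def)
  note Z = surface_map_one_vertex_pattern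
  obtain f where f: "ribbon_covering f (dual R) (dual ?Z)" "has_degree f (dual R) (dual ?Z) D"
    using assms(1) by (auto simp: branched_cover_def)
  obtain g where g: "ribbon_covering g (dual R) (dual ?T)"
    using assms(2) by (auto simp: branched_cover_def)
  note cf = covering_dualD[OF f(1) R Z] and cg = covering_dualD[OF g R T]
  let ?F = "{z \<in> darts R. f z = 0}"
  have pow: "(rot R ^^ k) z \<in> darts R" "f ((rot R ^^ k) z) = (rot ?Z ^^ k) (f z)"
    "g ((rot R ^^ k) z) = (rot ?T ^^ k) (g z)" if "z \<in> darts R" for k z
    by (induction k) (use that cf(4) cg(4) surface_mapD(4)[OF R] in auto)
  have "Pred ` darts icosahedron \<subseteq> g ` ?F"
  proof clarify
    fix d assume d: "d \<in> darts icosahedron"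
    then have "Pred d \<in> darts ?T" by (simp add: truncated_icosahedron_def truncation_simps)
    then obtain z where z: "z \<in> darts R" "g z = Pred d" using cg(1) by (metis imageE)
    have "card (face ?Z (f z)) = 5"
      using cf(6)[OF z(1)] cg(6)[OF z(1)] z(2) truncated_icosahedron_orbits(3)[OF d] by simp
    moreover have fz: "f z < 90" using cf(2)[OF z(1)] by (simp add: one_vertex_pattern_def)
    ultimately obtain m where m: "f z = 3 * m"
      using card_face_one_vertex_pattern[of "f z"] by (auto split: if_splits)
    \<comment> \<open>Turning by \<open>?k\<close> takes \<open>3 * m\<close> to 90, that is to the dart 0.\<close>
    let ?k = "3 * (30 - m)"
    have "(rot ?T ^^ (3 * j)) (Pred d) = Pred d" for j
      by (induction j) (simp_all add: numeral_3_eq_3 truncated_icosahedron_def truncation_simps)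
    then have "g ((rot R ^^ ?k) z) = Pred d" using pow(3)[OF z(1)] z(2) by simp
    moreover have "f ((rot R ^^ ?k) z) = 0"
      using pow(2)[OF z(1), of ?k] rot_power_one_vertex_pattern[OF fz, of ?k] m fz
      by (simp add: add_mult_distrib2[symmetric] del: add_mult_distrib2)
    ultimately show "Pred d \<in> g ` ?F" using pow(1)[OF z(1)] by (metis (mono_tags, lifting) imageI mem_Collect_eq)
  qed
  moreover have "finite ?F" using surface_mapD(1)[OF R] by simp
  ultimately have "60 \<le> card ?F"
    using card_darts_truncated_icosahedron(2) by (metis surj_card_le)
  also have "card ?F = D"
    using f(2) by (simp add: has_degree_def dual_def one_vertex_pattern_def)
  finally show ?thesis .
qed

theorem theorem3:
  shows "(\<forall>P :: 'a ribbon_graph. football_pattern P \<longrightarrow>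
            (\<exists>(P' :: nat ribbon_graph) D D'. D \<le> 60 \<and>
               branched_cover D P' P \<and> branched_cover D' P' truncated_icosahedron)) \<and>
         (\<exists>P :: nat ribbon_graph. football_pattern P \<and>
            (\<forall>(P' :: 'b ribbon_graph) D D'.
               branched_cover D P' P \<and> branched_cover D' P' truncated_icosahedron \<longrightarrow> D \<ge> 60))"
proof (intro conjI allI impI)
  fix P :: "'a ribbon_graph"
  assume "football_pattern P"
  from common_branched_cover[OF this football_pattern_truncated_icosahedron]
  show "\<exists>(P' :: nat ribbon_graph) D D'. D \<le> 60 \<and>
      branched_cover D P' P \<and> branched_cover D' P' truncated_icosahedron"
    unfolding card_pentagon_sides_truncated_icosahedron by metis
next
  show "\<exists>P :: nat ribbon_graph. football_pattern P \<and>
      (\<forall>(P' :: 'b ribbon_graph) D D'.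
         branched_cover D P' P \<and> branched_cover D' P' truncated_icosahedron \<longrightarrow> D \<ge> 60)"
    by (rule exI[of _ one_vertex_pattern])
      (simp add: football_pattern_one_vertex_pattern, metis one_vertex_pattern_degree_ge)
qed

end
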